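(* Let $1<\alpha<2$, $b>0$, $q\ge2$ an integer, $N=2^q$, $h=b/N$, $\kappa_\alpha=-1/(2\cos(\alpha\pi/2))$, and let $A_q=\frac{\kappa_\alpha}{h^{\alpha-1}\Gamma(4-\alpha)}B_h$ be the $(N-1)\times(N-1)$ matrix, where $B_h=(b_{i,j})$ is the symmetric matrix with $b_{i,i}=8-2^{4-\alpha}+\widetilde b_{i,i}$, $b_{i,i+1}=b_{i+1,i}=-7-3^{3-\alpha}+2^{5-\alpha}+\widetilde b_{i,i+1}$, and for $m=|j-i|\ge2$, $b_{i,j}=-(m+2)^{3-\alpha}+4(m+1)^{3-\alpha}-6m^{3-\alpha}+4(m-1)^{3-\alpha}-(m-2)^{3-\alpha}$, with $$\widetilde b_{i,i}=2\big[(i+1)^{3-\alpha}-2(3-\alpha)i^{2-\alpha}-(i-1)^{3-\alpha}\big]+2\big[(N-i+1)^{3-\alpha}-2(3-\alpha)(N-i)^{2-\alpha}-(N-i-1)^{3-\alpha}\big],$$ $$\widetilde b_{i,i+1}=-2\big[(i+1)^{3-\alpha}-i^{3-\alpha}\big]+(3-\alpha)\big[(i+1)^{2-\alpha}+i^{2-\alpha}\big]-2\big[(N-i)^{3-\alpha}-(N-i-1)^{3-\alpha}\big]+(3-\alpha)\big[(N-i)^{2-\alpha}+(N-i-1)^{2-\alpha}\big].$$ Let $D_q$ be the diagonal of $A_q$, let $\eta_0$ satisfy $\lambda_{\max}(D_q^{-1}A_q)\le\eta_0<2$, let $0<\omega<2/\eta_0$, let $0<\eta\le\omega(2-\omega\eta_0)$,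 and let $K_q=I-\omega D_q^{-1}A_q$. Then $\|K_q\nu\|_{A_q}^2\le\|\nu\|_{A_q}^2-\eta\|A_q\nu\|_{D_q^{-1}}^2$ for all $\nu\in\mathbb R^{N-1}$, and the two-grid iteration matrix satisfies $$\|K_qT^q\|_{A_q}\le\sqrt{1-2\eta/5}<1.$$
   Context: Here $0^p=0$ for $p>0$. For a symmetric positive definite $M$, $\|\nu\|_M=\sqrt{\nu^TM\nu}$ and for a matrix $X$, $\|X\|_M$ is the induced operator norm. The restriction $I_q^{q-1}:\mathbb R^{N-1}\to\mathbb R^{N/2-1}$ is $(I_q^{q-1}\nu)_i=\frac14(\nu_{2i-1}+2\nu_{2i}+\nu_{2i+1})$, $i=1,\dots,N/2-1$, and the prolongation is $I_{q-1}^q=2(I_q^{q-1})^T$. The coarse matrix is $A_{q-1}=I_q^{q-1}A_qI_{q-1}^q$ and the coarse grid correction operator is $T^q=I-I_{q-1}^qA_{q-1}^{-1}I_q^{q-1}A_q$. $K_q$ is the damped Jacobi iteration matrix; $K_qT^q$ is the two-grid method (TGM) iteration matrix. *)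

theory Defs
  imports "HOL-Analysis.Analysis" "Jordan_Normal_Form.Matrix" "Jordan_Normal_Form.Char_Poly"
    "Jordan_Normal_Form.Gauss_Jordan_Elimination"
begin

text \<open>Matrices are Jordan_Normal_Form matrices. Paper indices 1..N-1 correspond to
  JNF indices 0..N-2 (paper index = JNF index + 1).\<close>

definition kappa :: "real \<Rightarrow> real" where
  "kappa \<alpha> = - 1 / (2 * cos (\<alpha> * pi / 2))"

definition btd :: "real \<Rightarrow> nat \<Rightarrow> nat \<Rightarrow> real" where
  "btd \<alpha> N i =
     2 * ((real i + 1) powr (3 - \<alpha>) - 2 * (3 - \<alpha>) * real i powr (2 - \<alpha>) - (real i - 1) powr (3 - \<alpha>))
   + 2 * ((real N - real i + 1) powr (3 - \<alpha>) - 2 * (3 - \<alpha>) * (real N - real i) powr (2 - \<alpha>)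
          - (real N - real i - 1) powr (3 - \<alpha>))"

definition bto :: "real \<Rightarrow> nat \<Rightarrow> nat \<Rightarrow> real" where
  "bto \<alpha> N i =
     - 2 * ((real i + 1) powr (3 - \<alpha>) - real i powr (3 - \<alpha>))
   + (3 - \<alpha>) * ((real i + 1) powr (2 - \<alpha>) + real i powr (2 - \<alpha>))
   - 2 * ((real N - real i) powr (3 - \<alpha>) - (real N - real i - 1) powr (3 - \<alpha>))
   + (3 - \<alpha>) * ((real N - real i) powr (2 - \<alpha>) + (real N - real i - 1) powr (2 - \<alpha>))"

definition bfar :: "real \<Rightarrow> nat \<Rightarrow> real" where
  "bfar \<alpha> m = - ((real m + 2) powr (3 - \<alpha>)) + 4 * (real m + 1) powr (3 - \<alpha>)
     - 6 * real m powr (3 - \<alpha>) + 4 * (real m - 1) powr (3 - \<alpha>) - (real m - 2) powr (3 - \<alpha>)"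

text \<open>Entry b_{i,j} of B_h, paper indices i, j in 1..N-1.\<close>
definition bentry :: "real \<Rightarrow> nat \<Rightarrow> nat \<Rightarrow> nat \<Rightarrow> real" where
  "bentry \<alpha> N i j =
     (if i = j then 8 - 2 powr (4 - \<alpha>) + btd \<alpha> N i
      else if j = i + 1 then - 7 - 3 powr (3 - \<alpha>) + 2 powr (5 - \<alpha>) + bto \<alpha> N i
      else if i = j + 1 then - 7 - 3 powr (3 - \<alpha>) + 2 powr (5 - \<alpha>) + bto \<alpha> N j
      else bfar \<alpha> (if i \<le> j then j - i else i - j))"

definition Bh :: "real \<Rightarrow> nat \<Rightarrow> real mat" where
  "Bh \<alpha> N = mat (N - 1) (N - 1) (\<lambda>(r, c). bentry \<alpha> N (r + 1) (c + 1))"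

definition Aq :: "real \<Rightarrow> real \<Rightarrow> nat \<Rightarrow> real mat" where
  "Aq \<alpha> b q = (let N = 2 ^ q; h = b / real N in
     (kappa \<alpha> / (h powr (\<alpha> - 1) * Gamma (4 - \<alpha>))) \<cdot>\<^sub>m Bh \<alpha> N)"

definition diag_part :: "real mat \<Rightarrow> real mat" where
  "diag_part A = mat_diag (dim_row A) (\<lambda>i. A $$ (i, i))"

definition diag_inv :: "real mat \<Rightarrow> real mat" where
  "diag_inv A = mat_diag (dim_row A) (\<lambda>i. 1 / A $$ (i, i))"

definition restr :: "nat \<Rightarrow> real mat" where
  "restr N = mat (N div 2 - 1) (N - 1) (\<lambda>(r, c).
     let i = r + 1; k = c + 1 in
     if k = 2 * i then 1 / 2 else if k + 1 = 2 * i \<or> k = 2 * i + 1 then 1 / 4 else 0)"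

definition prolong :: "nat \<Rightarrow> real mat" where
  "prolong N = 2 \<cdot>\<^sub>m (restr N)\<^sup>T"

definition coarse_mat :: "nat \<Rightarrow> real mat \<Rightarrow> real mat" where
  "coarse_mat N A = restr N * A * prolong N"

definition cgc :: "nat \<Rightarrow> real mat \<Rightarrow> real mat" where
  "cgc N A = 1\<^sub>m (N - 1) - prolong N * the (mat_inverse (coarse_mat N A)) * restr N * A"

definition jacobi :: "real \<Rightarrow> real mat \<Rightarrow> real mat" where
  "jacobi \<omega> A = 1\<^sub>m (dim_row A) - \<omega> \<cdot>\<^sub>m (diag_inv A * A)"

definition vnorm :: "real mat \<Rightarrow> real vec \<Rightarrow> real" where
  "vnorm M v = sqrt (v \<bullet> (M *\<^sub>v v))"

definition opnorm :: "real mat \<Rightarrow> real mat \<Rightarrow> real" where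
  "opnorm M X = Sup {vnorm M (X *\<^sub>v v) / vnorm M v | v. v \<in> carrier_vec (dim_col X) \<and> v \<noteq> 0\<^sub>v (dim_col X)}"

end

theory Submission
  imports Defs
begin

text \<open>
  Put \<open>s = 3 - \<alpha>\<close>. The Toeplitz part of \<open>B\<^sub>h\<close> consists of fourth differences of \<open>|t|\<^sup>s\<close>, the corrections are
  midpoint and trapezoidal quadrature defects of \<open>t\<^sup>s\<^sup>-\<^sup>1\<close>. Concavity makes all off-diagonal entries
  nonpositive, and the row sums telescope to differences between a second difference of
  \<open>s t\<^sup>s\<^sup>-\<^sup>1\<close> and its mean over a unit interval, hence are nonnegative. So the energy of \<open>B\<^sub>h\<close> dominates a weighted
  sum of squared nearest-neighbour increments, in which each edge weight (including the two
  boundary edges, weighted by row sums) is at least one fifth of the adjacent diagonal entries.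
  Interpolating the even nodes therefore gives the approximation property with constant 5/2.

  The smoothing property is the Rayleigh bound \<open>A \<le> \<eta>\<^sub>0 D\<close>. Since the coarse grid correction is the
  \<open>A\<close>-orthogonal projection off the range of the prolongation, both properties combine to the
  contraction factor \<open>1 - \<eta> / (5/2)\<close>.
\<close>

unbundle no inner_syntax and no vec_syntax

section \<open>Finite differences of powers\<close>

text \<open>Weighted AM-GM for \<open>x\<close> and \<open>k\<close>, multiplied by
  \<open>k powr (r - 1)\<close>. Allowing \<open>x = 0\<close> covers trapezoidal cells that start
  at the origin.\<close>

lemma powr_le_tangent:
  fixes r x k :: real
  assumes "0 < r" "r < 1" "0 \<le> x" "0 < k"
  shows "x powr r \<le> k powr r + r * k powr (r - 1) * (x - k)"
proof -
  have k1: "k powr (r - 1) * k = k powr r"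
    using assms by (metis diff_add_cancel mult.commute powr_mult_base less_imp_le add.commute)
  show ?thesis
  proof (cases "x = 0")
    case True
    have "r * k powr r \<le> 1 * k powr r"
      using assms by (intro mult_right_mono) auto
    with True k1 show ?thesis by (simp add: algebra_simps)
  next
    case False
    have "x powr r * k powr (1 - r) \<le> r * x + (1 - r) * k"
      using Youngs_inequality_0[of r "1 - r" x k] assms False by simp
    then have "k powr (r - 1) * (x powr r * k powr (1 - r)) \<le> k powr (r - 1) * (r * x + (1 - r) * k)"
      by (intro mult_left_mono) auto
    moreover have "k powr (r - 1) * (x powr r * k powr (1 - r)) = x powr r"
      using assms powr_add[of k "r - 1" "1 - r"] by (simp add: algebra_simps)
    moreover have "k powr (r - 1) * (r * x + (1 - r) * k) = k powr r + r * k powr (r - 1) * (x - k)"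
      using k1 by (simp add: algebra_simps)
    ultimately show ?thesis by simp
  qed
qed

text \<open>Since \<open>(x + 1) * (x - 1)\<close> is below \<open>x * x\<close> and the exponent is
  nonpositive, \<open>x powr r\<close> is at most the geometric mean of the outer terms, hence at
  most their arithmetic mean.\<close>

lemma powr_second_difference_nonneg:
  fixes r x :: real
  assumes "r \<le> 0" "1 < x"
  shows "0 \<le> (x + 1) powr r - 2 * x powr r + (x - 1) powr r"
proof -
  define a where "a = (x + 1) powr (r / 2)"
  define c where "c = (x - 1) powr (r / 2)"
  have "x powr r = (x * x) powr (r / 2)"
    using assms by (simp add: powr_mult flip: powr_add)
  also have "\<dots> \<le> ((x + 1) * (x - 1)) powr (r / 2)"
    using assms by (intro powr_mono2') (auto simp: algebra_simps power2_eq_square mult_less_cancel_left1 intro!: less_1_mult)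
  also have "\<dots> = a * c"
    using assms by (simp add: a_def c_def powr_mult)
  finally have "x powr r \<le> a * c" .
  moreover have "0 \<le> (a - c)\<^sup>2" by simp
  moreover have "a\<^sup>2 = (x + 1) powr r" "c\<^sup>2 = (x - 1) powr r"
    using assms by (simp_all add: a_def c_def power2_eq_square flip: powr_add)
  ultimately show ?thesis by (simp add: power2_diff)
qed

lemma DERIV_powr_chain:
  fixes g :: "real \<Rightarrow> real"
  assumes "(g has_real_derivative g') (at x)" "0 < g x"
  shows "((\<lambda>x. g x powr r) has_real_derivative r * g x powr (r - 1) * g') (at x)"
  using DERIV_fun_powr[OF assms] by simp

text \<open>Twice the signed error (rule minus integral) of the trapezoidal rule for
  \<open>s * t powr (s - 1)\<close> from \<open>k\<close> to \<open>k + 1\<close>.\<close>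

definition trap_defect :: "real \<Rightarrow> real \<Rightarrow> real" where
  "trap_defect s k = - 2 * ((k + 1) powr s - k powr s) + s * ((k + 1) powr (s - 1) + k powr (s - 1))"

text \<open>Twice the signed error (integral minus rule) of the midpoint rule for the same integrand
  from \<open>k - 1\<close> to \<open>k + 1\<close>.\<close>

definition mid_defect :: "real \<Rightarrow> real \<Rightarrow> real" where
  "mid_defect s k = 2 * ((k + 1) powr s - 2 * s * k powr (s - 1) - (k - 1) powr s)"

text \<open>The integrand is concave, so the trapezoidal rule lies below the integral.\<close>

lemma trap_defect_nonpos:
  assumes s: "1 < s" "s < 2" and k: "0 \<le> k"
  shows "trap_defect s k \<le> 0"
proof -
  \<comment> \<open>The negated defect of a cell of width \<open>t\<close>: it is 0 at
    \<open>t = 0\<close> and \<open>- trap_defect s k\<close> at \<open>t = 1\<close>.\<close>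
  define \<phi> where "\<phi> t = 2 * ((k + t) powr s - k powr s) - s * t * ((k + t) powr (s - 1) + k powr (s - 1))" for t
  have "\<phi> 0 \<le> \<phi> 1"
  proof (rule DERIV_nonneg_imp_increasing_open[where f = \<phi>])
    \<comment> \<open>Continuity suffices at the ends; for \<open>k = 0\<close> the base vanishes at
      \<open>t = 0\<close>, outside the reach of the chain rule for \<open>powr\<close>.\<close>
    show "continuous_on {0..1} \<phi>"
      unfolding \<phi>_def using s k by (intro continuous_intros continuous_on_powr') auto
    fix t :: real assume t: "0 < t" "t < 1"
    have D: "(\<phi> has_real_derivative
        s * ((k + t) powr (s - 1) - k powr (s - 1) - (s - 1) * (k + t) powr (s - 1 - 1) * t)) (at t)"
      unfolding \<phi>_def
      by (insert t k, rule DERIV_cong,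
          (rule DERIV_const DERIV_powr_chain DERIV_add DERIV_diff DERIV_mult DERIV_ident
            | (simp add: algebra_simps; fail))+)
    moreover have "k powr (s - 1) \<le> (k + t) powr (s - 1) + (s - 1) * (k + t) powr (s - 1 - 1) * (k - (k + t))"
      using s k t by (intro powr_le_tangent) auto
    ultimately have "0 \<le> s * ((k + t) powr (s - 1) - k powr (s - 1) - (s - 1) * (k + t) powr (s - 1 - 1) * t)"
      using s by (intro mult_nonneg_nonneg) auto
    with D show "\<exists>y. (\<phi> has_real_derivative y) (at t) \<and> 0 \<le> y"
      by blast
  qed simp
  then show ?thesis by (simp add: \<phi>_def trap_defect_def)
qed

text \<open>By concavity the midpoint rule lies above the integral: the derivative of the error in
  the half-width \<open>t\<close> is a symmetric second difference about \<open>k\<close>.\<close>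

lemma mid_defect_nonpos:
  assumes s: "1 < s" "s < 2" and k: "1 \<le> k"
  shows "mid_defect s k \<le> 0"
proof -
  define \<phi> where "\<phi> t = (k + t) powr s - (k - t) powr s - 2 * s * t * k powr (s - 1)" for t
  have "\<phi> 1 \<le> \<phi> 0"
  proof (rule DERIV_nonpos_imp_decreasing_open[where f = \<phi>])
    show "continuous_on {0..1} \<phi>"
      unfolding \<phi>_def using s k by (intro continuous_intros continuous_on_powr') auto
    fix t :: real assume t: "0 < t" "t < 1"
    have D: "(\<phi> has_real_derivative
        s * ((k + t) powr (s - 1) + (k - t) powr (s - 1) - 2 * k powr (s - 1))) (at t)"
      unfolding \<phi>_def
      by (insert t k, rule DERIV_cong,
          (rule DERIV_const DERIV_powr_chain DERIV_add DERIV_diff DERIV_mult DERIV_ident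
            | (simp add: algebra_simps; fail))+)
    moreover have "(k + t) powr (s - 1) \<le> k powr (s - 1) + (s - 1) * k powr (s - 1 - 1) * (k + t - k)"
      using s k t by (intro powr_le_tangent) auto
    moreover have "(k - t) powr (s - 1) \<le> k powr (s - 1) + (s - 1) * k powr (s - 1 - 1) * (k - t - k)"
      using s k t by (intro powr_le_tangent) auto
    ultimately have "(s * ((k + t) powr (s - 1) + (k - t) powr (s - 1) - 2 * k powr (s - 1))) \<le> 0"
      using s by (intro mult_nonneg_nonpos) auto
    with D show "\<exists>y. (\<phi> has_real_derivative y) (at t) \<and> y \<le> 0"
      by blast
  qed simp
  then show ?thesis by (simp add: \<phi>_def mid_defect_def)
qed

section \<open>Second and third differences of powers\<close>

definition second_diff :: "(real \<Rightarrow> real) \<Rightarrow> real \<Rightarrow> real" where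
  "second_diff f x = f (x + 1) - 2 * f x + f (x - 1)"

text \<open>Differentiation leaves \<open>s - 1\<close> times a second difference of the convex
  function \<open>t powr (s - 2)\<close>. At \<open>x = 1\<close> a base vanishes, so the endpoint
  is reached by continuity only.\<close>

lemma second_diff_deriv_mono:
  assumes s: "1 < s" "s < 2" and xy: "1 \<le> x" "x \<le> y"
  shows "second_diff (\<lambda>t. t powr (s - 1)) x \<le> second_diff (\<lambda>t. t powr (s - 1)) y"
  unfolding second_diff_def
proof (rule DERIV_nonneg_imp_increasing_open[OF xy(2)])
  show "continuous_on {x..y} (\<lambda>x. (x + 1) powr (s - 1) - 2 * x powr (s - 1) + (x - 1) powr (s - 1))"
    using s xy by (intro continuous_intros continuous_on_powr') auto
  fix t :: real assume t: "x < t" "t < y"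
  have D: "((\<lambda>x. (x + 1) powr (s - 1) - 2 * x powr (s - 1) + (x - 1) powr (s - 1)) has_real_derivative
      (s - 1) * ((t + 1) powr (s - 2) - 2 * t powr (s - 2) + (t - 1) powr (s - 2))) (at t)"
    by (insert t xy, rule DERIV_cong,
          (rule DERIV_const DERIV_powr_chain DERIV_add DERIV_diff DERIV_mult DERIV_ident
            | (simp add: algebra_simps; fail))+)
  moreover have "0 \<le> (t + 1) powr (s - 2) - 2 * t powr (s - 2) + (t - 1) powr (s - 2)"
    using s xy t by (intro powr_second_difference_nonneg) auto
  ultimately have "0 \<le> (s - 1) * ((t + 1) powr (s - 2) - 2 * t powr (s - 2) + (t - 1) powr (s - 2))"
    using s by (intro mult_nonneg_nonneg) auto
  with D show "\<exists>y. ((\<lambda>x. (x + 1) powr (s - 1) - 2 * x powr (s - 1) + (x - 1) powr (s - 1)) has_real_derivative y) (at t) \<and> 0 \<le> y"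
    by blast
qed

definition third_diff :: "(real \<Rightarrow> real) \<Rightarrow> real \<Rightarrow> real" where
  "third_diff f x = second_diff f x - second_diff f (x - 1)"

text \<open>By the mean value theorem the third difference is the derivative of the second
  difference at a point between \<open>x - 1\<close> and \<open>x\<close>. That derivative is
  monotone, so its endpoint values are the bounds.\<close>

lemma third_diff_powr_bounds:
  assumes s: "1 < s" "s < 2" and x: "2 \<le> x"
  shows "s * second_diff (\<lambda>t. t powr (s - 1)) (x - 1) \<le> third_diff (\<lambda>t. t powr s) x"
    and "third_diff (\<lambda>t. t powr s) x \<le> s * second_diff (\<lambda>t. t powr (s - 1)) x"
proof -
  let ?p = "\<lambda>x. s * second_diff (\<lambda>t. t powr (s - 1)) x"
  have D: "(second_diff (\<lambda>t. t powr s) has_real_derivative ?p t) (at t)" if "x - 1 < t" for t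
    unfolding second_diff_def
    by (insert that x, rule DERIV_cong,
          (rule DERIV_const DERIV_powr_chain DERIV_add DERIV_diff DERIV_mult DERIV_ident
            | (simp add: algebra_simps; fail))+)
  have cont: "continuous_on {x - 1..x} (second_diff (\<lambda>t. t powr s))"
    unfolding second_diff_def using s x by (intro continuous_intros continuous_on_powr') auto
  have diff: "second_diff (\<lambda>t. t powr s) differentiable (at t)" if "x - 1 < t" "t < x" for t
    using D[OF that(1)] real_differentiable_def by blast
  obtain l z where z: "x - 1 < z" "z < x" and l: "(second_diff (\<lambda>t. t powr s) has_real_derivative l) (at z)"
    and eq: "second_diff (\<lambda>t. t powr s) x - second_diff (\<lambda>t. t powr s) (x - 1) = (x - (x - 1)) * l"
    using MVT[OF _ cont diff] by auto
  have "l = ?p z" using D[OF z(1)] l DERIV_unique by blast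
  then have "third_diff (\<lambda>t. t powr s) x = ?p z" using eq by (simp add: third_diff_def)
  moreover have "?p (x - 1) \<le> ?p z" "?p z \<le> ?p x"
    using s x z by (auto intro!: mult_left_mono second_diff_deriv_mono)
  ultimately show "?p (x - 1) \<le> third_diff (\<lambda>t. t powr s) x" "third_diff (\<lambda>t. t powr s) x \<le> ?p x"
    by simp_all
qed

lemma bfar_eq_third_diff:
  "bfar \<alpha> m = third_diff (\<lambda>t. t powr (3 - \<alpha>)) (real m) - third_diff (\<lambda>t. t powr (3 - \<alpha>)) (real m + 1)"
  by (simp add: bfar_def third_diff_def second_diff_def add.commute)

text \<open>The derivative of the second difference at \<open>m\<close> separates the two third
  differences: it bounds the one at \<open>m\<close> from above and the one at \<open>m + 1\<close>
  from below.\<close>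

lemma bfar_nonpos:
  assumes "1 < \<alpha>" "\<alpha> < 2" "2 \<le> m"
  shows "bfar \<alpha> m \<le> 0"
proof -
  have "third_diff (\<lambda>t. t powr (3 - \<alpha>)) (real m) \<le> (3 - \<alpha>) * second_diff (\<lambda>t. t powr (3 - \<alpha> - 1)) (real m)"
    using assms by (intro third_diff_powr_bounds) auto
  also have "\<dots> \<le> third_diff (\<lambda>t. t powr (3 - \<alpha>)) (real m + 1)"
    using third_diff_powr_bounds(1)[of "3 - \<alpha>" "real m + 1"] assms by simp
  finally show ?thesis by (simp add: bfar_eq_third_diff)
qed

text \<open>Equality holds at \<open>s = 2\<close>; the derivatives compare because \<open>3 ^ 5 < 2 ^ 8\<close>.\<close>
lemma toeplitz_diag_le_offdiag:
  fixes s :: real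
  assumes "s \<le> 2"
  shows "8 - 2 * 2 powr s \<le> 5 * (7 + 3 powr s - 4 * 2 powr s)"
proof -
  \<comment> \<open>Collecting terms turns the claim into \<open>- 27 \<le> g s\<close>, with
    \<open>18 = 5 * 4 - 2\<close> and \<open>g 2 = - 27\<close>.\<close>
  define g where "g x = 5 * 3 powr x - 18 * (2::real) powr x" for x :: real
  have "5 * ln 3 = ln (3 ^ 5 :: real)" by (subst ln_realpow) auto
  also have "\<dots> \<le> ln (2 ^ 8)" by simp
  also have "\<dots> = 8 * ln (2::real)" by (subst ln_realpow) auto
  finally have ln: "5 * ln 3 \<le> 8 * ln (2::real)" .
  have "g 2 \<le> g s"
  proof (rule DERIV_nonpos_imp_nonincreasing[OF assms])
    fix x assume x: "s \<le> x" "x \<le> 2"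
    have "(3 / 2) powr x \<le> (3 / 2) powr (2::real)" using x by (intro powr_mono) auto
    then have "3 powr x \<le> 9 / 4 * 2 powr x"
      by (simp add: powr_divide field_simps)
    with ln have "(5 * ln 3) * 3 powr x \<le> (8 * ln 2) * (9 / 4 * 2 powr x)"
      by (rule mult_mono) auto
    moreover have "(g has_real_derivative 5 * ln 3 * 3 powr x - 18 * ln 2 * 2 powr x) (at x)"
      unfolding g_def by (rule derivative_eq_intros refl | simp)+
    ultimately show "\<exists>y. (g has_real_derivative y) (at x) \<and> y \<le> 0"
      by (intro exI[of _ "5 * ln 3 * 3 powr x - 18 * ln 2 * 2 powr x"] conjI) auto
  qed
  then show ?thesis by (simp add: g_def)
qed

section \<open>Entries and row sums of the stiffness matrix\<close>

lemma btd_eq: "btd \<alpha> N i = mid_defect (3 - \<alpha>) (real i) + mid_defect (3 - \<alpha>) (real N - real i)"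
  by (simp add: btd_def mid_defect_def)

lemma bto_eq: "bto \<alpha> N i = trap_defect (3 - \<alpha>) (real i) + trap_defect (3 - \<alpha>) (real N - real i - 1)"
  by (simp add: bto_def trap_defect_def)

text \<open>The midpoint rule and the two trapezoidal rules approximate the same integral from
  \<open>k - 1\<close> to \<open>k + 1\<close>; the integrals cancel and only nodal values
  remain.\<close>

lemma mid_plus_trap_defects:
  "mid_defect s k + trap_defect s k + trap_defect s (k - 1) = s * second_diff (\<lambda>t. t powr (s - 1)) k"
  by (simp add: mid_defect_def trap_defect_def second_diff_def algebra_simps)

text \<open>Third differences of the even extension of \<open>t powr s\<close>; \<open>third_diff\<close> itself only agrees
  with them from 2 on because of the junk values of \<open>powr\<close> at negative arguments.\<close>
definition even_third_diff :: "real \<Rightarrow> int \<Rightarrow> real" where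
  "even_third_diff s k = third_diff (\<lambda>t. \<bar>t\<bar> powr s) (real_of_int k)"

text \<open>The stencil at \<open>k\<close> is centred at \<open>k - 1/2\<close>; reflecting an even
  function at 0 changes the sign of an odd-order difference.\<close>

lemma even_third_diff_reflect: "even_third_diff s (1 - k) = - even_third_diff s k"
proof -
  have "\<bar>1 - real_of_int k + 1\<bar> = \<bar>real_of_int k - 2\<bar>" "\<bar>1 - real_of_int k\<bar> = \<bar>real_of_int k - 1\<bar>"
    "\<bar>1 - real_of_int k - 1 - 1\<bar> = \<bar>real_of_int k + 1\<bar>" by auto
  then show ?thesis by (simp add: even_third_diff_def third_diff_def second_diff_def)
qed

lemma even_third_diff_eq: "2 \<le> k \<Longrightarrow> even_third_diff s k = third_diff (\<lambda>t. t powr s) (real_of_int k)"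
  by (simp add: even_third_diff_def third_diff_def second_diff_def)

lemma even_third_diff_1: "even_third_diff s 1 = 2 powr s - 4"
  by (simp add: even_third_diff_def third_diff_def second_diff_def)

lemma even_third_diff_2: "even_third_diff s 2 = 3 powr s - 3 * 2 powr s + 3"
  by (simp add: even_third_diff_def third_diff_def second_diff_def)

text \<open>Minus the fourth central difference of the even extension, written so that row sums
  telescope.\<close>

definition toep :: "real \<Rightarrow> int \<Rightarrow> real" where
  "toep s k = even_third_diff s k - even_third_diff s (k + 1)"

lemma toep_uminus: "toep s (- k) = toep s k"
  using even_third_diff_reflect[of s k] even_third_diff_reflect[of s "k + 1"]
  by (simp add: toep_def)

lemma toep_0: "toep s 0 = 8 - 2 * 2 powr s"
  using even_third_diff_reflect[of s 1] by (simp add: toep_def even_third_diff_1)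

lemma toep_1: "toep s 1 = - 7 - 3 powr s + 4 * 2 powr s"
  by (simp add: toep_def even_third_diff_1 even_third_diff_2)

lemma toep_ge2: "2 \<le> m \<Longrightarrow> toep (3 - \<alpha>) (int m) = bfar \<alpha> m"
  by (simp add: toep_def bfar_eq_third_diff even_third_diff_eq)

text \<open>One formula, Toeplitz part plus tridiagonal correction, for all positions of
  \<open>i\<close> and \<open>j\<close>, so that row sums can be split.\<close>

lemma bentry_eq:
  "bentry \<alpha> N i j = toep (3 - \<alpha>) (int j - int i)
     + ((if j = i then btd \<alpha> N i else 0) + (if j = i + 1 then bto \<alpha> N i else 0)
        + (if j + 1 = i then bto \<alpha> N j else 0))"
proof -
  have p: "(2::real) powr (4 - \<alpha>) = 2 * 2 powr (3 - \<alpha>)" "(2::real) powr (5 - \<alpha>) = 4 * 2 powr (3 - \<alpha>)"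
    using powr_add[of 2 1 "3 - \<alpha>"] powr_add[of 2 2 "3 - \<alpha>"] by simp_all
  consider "j = i" | "j = i + 1" | "i = j + 1" | "i + 2 \<le> j" | "j + 2 \<le> i" by linarith
  then show ?thesis
  proof cases
    case 3
    then have "toep (3 - \<alpha>) (int j - int i) = toep (3 - \<alpha>) 1"
      using toep_uminus[of "3 - \<alpha>" 1] by simp
    with 3 p show ?thesis by (simp add: bentry_def toep_1)
  next
    case 4
    then have "toep (3 - \<alpha>) (int j - int i) = bfar \<alpha> (j - i)"
      using toep_ge2[of "j - i" \<alpha>] by (simp add: of_nat_diff)
    with 4 show ?thesis by (simp add: bentry_def)
  next
    case 5
    then have "toep (3 - \<alpha>) (int j - int i) = bfar \<alpha> (i - j)"
      using toep_ge2[of "i - j" \<alpha>] toep_uminus[of "3 - \<alpha>" "int i - int j"] by (simp add: of_nat_diff)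
    with 5 show ?thesis by (simp add: bentry_def)
  qed (use p in \<open>simp_all add: bentry_def toep_0 toep_1\<close>)
qed

lemma bentry_sym: "bentry \<alpha> N i j = bentry \<alpha> N j i"
  using toep_uminus[of "3 - \<alpha>" "int i - int j"] by (auto simp: bentry_eq)

section \<open>Row sums and signs of the entries\<close>

definition row_sum :: "real \<Rightarrow> nat \<Rightarrow> nat \<Rightarrow> real" where
  "row_sum \<alpha> N i = (\<Sum>j\<in>{1..<N}. bentry \<alpha> N i j)"

text \<open>The share of one end of the interval, at distance \<open>k\<close>, in a row
  sum.\<close>

definition side_defect :: "real \<Rightarrow> nat \<Rightarrow> real" where
  "side_defect s k = s * second_diff (\<lambda>t. t powr (s - 1)) (real k) - even_third_diff s (int k)"

text \<open>The Toeplitz part telescopes to one third difference per end, and the corrections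
  combine by \<open>mid_plus_trap_defects\<close>. The first and last rows lack one neighbour, whose
  correction is taken off; \<open>3 \<le> N\<close> keeps these rows distinct.\<close>

lemma row_sum_eq:
  assumes "1 \<le> i" "i < N" "3 \<le> N"
  shows "row_sum \<alpha> N i = side_defect (3 - \<alpha>) i + side_defect (3 - \<alpha>) (N - i)
     - (if i = 1 \<or> i = N - 1 then trap_defect (3 - \<alpha>) 0 + trap_defect (3 - \<alpha>) (real N - 1) else 0)"
proof -
  let ?s = "3 - \<alpha>"
  let ?h = "\<lambda>j. even_third_diff ?s (int j - int i)"
  have "(\<Sum>j\<in>{1..<N}. toep ?s (int j - int i)) = - (\<Sum>j\<in>{1..<N}. ?h (Suc j) - ?h j)"
    by (simp add: toep_def sum_subtractf algebra_simps)
  also have "\<dots> = ?h 1 - ?h N"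
    using assms sum_Suc_diff'[of 1 N ?h] by simp
  also have "\<dots> = - even_third_diff ?s (int i) - even_third_diff ?s (int (N - i))"
    using assms even_third_diff_reflect[of ?s "int i"] by (simp add: of_nat_diff)
  finally have T: "(\<Sum>j\<in>{1..<N}. toep ?s (int j - int i))
      = - even_third_diff ?s (int i) - even_third_diff ?s (int (N - i))" .
  have B3: "(\<Sum>j\<in>{1..<N}. if j + 1 = i then bto \<alpha> N j else 0) = (if i = 1 then 0 else bto \<alpha> N (i - 1))"
  proof -
    have "(\<Sum>j\<in>{1..<N}. if j + 1 = i then bto \<alpha> N j else 0)
        = (\<Sum>j\<in>{1..<N}. if j = i - 1 then bto \<alpha> N (i - 1) else 0)"
      using assms by (intro sum.cong) auto
    then show ?thesis using assms by (auto simp: sum.delta)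
  qed
  have "row_sum \<alpha> N i = - even_third_diff ?s (int i) - even_third_diff ?s (int (N - i))
      + btd \<alpha> N i + (if i = N - 1 then 0 else bto \<alpha> N i) + (if i = 1 then 0 else bto \<alpha> N (i - 1))"
    unfolding row_sum_def bentry_eq sum.distrib T B3 using assms by auto
  also have "\<dots> = - even_third_diff ?s (int i) - even_third_diff ?s (int (N - i))
      + (btd \<alpha> N i + bto \<alpha> N i + bto \<alpha> N (i - 1))
      - (if i = 1 \<or> i = N - 1 then trap_defect ?s 0 + trap_defect ?s (real N - 1) else 0)"
  proof -
    have "bto \<alpha> N (N - 1) = trap_defect ?s 0 + trap_defect ?s (real N - 1)" "bto \<alpha> N 0 = trap_defect ?s 0 + trap_defect ?s (real N - 1)"
      using assms by (simp_all add: bto_eq of_nat_diff)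
    then show ?thesis using assms by auto
  qed
  also have "btd \<alpha> N i + bto \<alpha> N i + bto \<alpha> N (i - 1)
      = ?s * second_diff (\<lambda>t. t powr (?s - 1)) (real i) + ?s * second_diff (\<lambda>t. t powr (?s - 1)) (real (N - i))"
    using mid_plus_trap_defects[of ?s "real i"] mid_plus_trap_defects[of ?s "real N - real i"] assms
    by (simp add: btd_eq bto_eq of_nat_diff)
  finally show ?thesis by (simp add: side_defect_def)
qed

lemma side_defect_nonneg:
  assumes "1 < s" "s < 2" "2 \<le> k"
  shows "0 \<le> side_defect s k"
  using third_diff_powr_bounds(2)[of s "real k"] assms by (simp add: side_defect_def even_third_diff_eq)

text \<open>The share of the near end in a boundary row, including the missing neighbour's
  \<open>trap_defect s 0 = s - 2\<close>. For \<open>s = 3 - \<alpha>\<close> the first factor is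
  \<open>\<alpha> - 1\<close>.\<close>

lemma side_defect_1:
  assumes "1 < s"
  shows "side_defect s 1 - trap_defect s 0 = (2 - s) * (3 - 2 powr (s - 1))"
proof -
  have "(2::real) powr s = 2 * 2 powr (s - 1)" using powr_add[of 2 1 "s - 1"] by simp
  with assms show ?thesis
    by (simp add: side_defect_def even_third_diff_1 trap_defect_def second_diff_def algebra_simps)
qed

text \<open>In inner rows both shares are nonnegative. In a boundary row the near end is known in
  closed form and the far end only adds; this explicit bound later serves as a boundary edge
  weight.\<close>

lemma row_sum_nonneg:
  assumes \<alpha>: "1 < \<alpha>" "\<alpha> < 2" and i: "1 \<le> i" "i < N" and N: "3 \<le> N"
  shows "0 \<le> row_sum \<alpha> N i"
    and "i = 1 \<or> i = N - 1 \<Longrightarrow> (\<alpha> - 1) * (3 - 2 powr (2 - \<alpha>)) \<le> row_sum \<alpha> N i"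
proof -
  have tr: "trap_defect (3 - \<alpha>) (real N - 1) \<le> 0"
    using assms by (intro trap_defect_nonpos) auto
  have 1: "side_defect (3 - \<alpha>) 1 - trap_defect (3 - \<alpha>) 0 = (\<alpha> - 1) * (3 - 2 powr (2 - \<alpha>))"
    using side_defect_1[of "3 - \<alpha>"] \<alpha> by simp
  have N1: "0 \<le> side_defect (3 - \<alpha>) (N - 1)"
    using assms by (intro side_defect_nonneg) auto
  show A: "i = 1 \<or> i = N - 1 \<Longrightarrow> (\<alpha> - 1) * (3 - 2 powr (2 - \<alpha>)) \<le> row_sum \<alpha> N i"
    using row_sum_eq[OF i N, of \<alpha>] tr 1 N1 N by auto
  have "(2::real) powr (2 - \<alpha>) \<le> 2 powr 1"
    using \<alpha> by (intro powr_mono) auto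
  then have "0 \<le> (\<alpha> - 1) * (3 - 2 powr (2 - \<alpha>))" using \<alpha> by (intro mult_nonneg_nonneg) auto
  with A show "0 \<le> row_sum \<alpha> N i"
  proof (cases "i = 1 \<or> i = N - 1")
    case False
    then have "0 \<le> side_defect (3 - \<alpha>) i" "0 \<le> side_defect (3 - \<alpha>) (N - i)"
      using assms by (auto intro!: side_defect_nonneg)
    with False show ?thesis using row_sum_eq[OF i N, of \<alpha>] by simp
  qed auto
qed

text \<open>Distant entries are covered by \<open>bfar_nonpos\<close>; for neighbours
  \<open>bto\<close> only lowers the Toeplitz entry. The left side of the second claim is the
  Toeplitz diagonal, which bounds every diagonal entry from above.\<close>

lemma bentry_offdiag_nonpos:
  assumes \<alpha>: "1 < \<alpha>" "\<alpha> < 2" and ij: "i \<in> {1..<N}" "j \<in> {1..<N}" "i \<noteq> j"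
  shows "bentry \<alpha> N i j \<le> 0"
    and "j = i + 1 \<Longrightarrow> 8 - 2 * 2 powr (3 - \<alpha>) \<le> - 5 * bentry \<alpha> N i j"
proof -
  have neighbour: "8 - 2 * 2 powr (3 - \<alpha>) \<le> - 5 * bentry \<alpha> N i (i + 1) \<and> bentry \<alpha> N i (i + 1) \<le> 0"
    if "1 \<le> i" "i + 1 < N" for i
  proof -
    have "bto \<alpha> N i \<le> 0"
      unfolding bto_eq using that \<alpha> by (intro add_nonpos_nonpos trap_defect_nonpos) auto
    moreover have "8 - 2 * 2 powr (3 - \<alpha>) \<le> 5 * (7 + 3 powr (3 - \<alpha>) - 4 * 2 powr (3 - \<alpha>))"
      using \<alpha> by (intro toeplitz_diag_le_offdiag) auto
    moreover have "(2::real) powr (3 - \<alpha>) \<le> 2 powr 2"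
      using \<alpha> by (intro powr_mono) auto
    moreover have "bentry \<alpha> N i (i + 1) = - (7 + 3 powr (3 - \<alpha>) - 4 * 2 powr (3 - \<alpha>)) + bto \<alpha> N i"
      by (simp add: bentry_eq toep_1)
    ultimately show ?thesis by simp
  qed
  then show "j = i + 1 \<Longrightarrow> 8 - 2 * 2 powr (3 - \<alpha>) \<le> - 5 * bentry \<alpha> N i j"
    using ij by auto
  consider "j = i + 1" | "i = j + 1" | "i + 2 \<le> j" | "j + 2 \<le> i" using ij by linarith
  then show "bentry \<alpha> N i j \<le> 0"
  proof cases
    case 1 then show ?thesis using neighbour[of i] ij by auto
  next
    case 2 then show ?thesis using neighbour[of j] ij bentry_sym[of \<alpha> N i j] by auto
  next
    case 3 then show ?thesis using bfar_nonpos[OF \<alpha>, of "j - i"] by (simp add: bentry_def)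
  next
    case 4 then show ?thesis using bfar_nonpos[OF \<alpha>, of "i - j"] by (simp add: bentry_def)
  qed
qed

text \<open>Nodes 0 and \<open>N\<close> carry the homogeneous boundary values, so the first and last row sums act as
  the weights of the two boundary edges.\<close>
definition edge_weight :: "real \<Rightarrow> nat \<Rightarrow> nat \<Rightarrow> real" where
  "edge_weight \<alpha> N e = (if e = 0 then row_sum \<alpha> N 1 else if e + 1 = N then row_sum \<alpha> N (N - 1)
     else - bentry \<alpha> N e (e + 1))"

text \<open>Strictness rests on \<open>1 < \<alpha>\<close>: at \<alpha> = 1 the explicit lower
  bounds for boundary row sums and neighbour entries both degenerate to 0.\<close>

lemma edge_weight_pos:
  assumes \<alpha>: "1 < \<alpha>" "\<alpha> < 2" and e: "e < N" and N: "3 \<le> N"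
  shows "0 < edge_weight \<alpha> N e"
proof -
  have "(2::real) powr (2 - \<alpha>) \<le> 2 powr 1"
    using \<alpha> by (intro powr_mono) auto
  then have "0 < (\<alpha> - 1) * (3 - 2 powr (2 - \<alpha>))" using \<alpha> by (intro mult_pos_pos) auto
  then have "0 < row_sum \<alpha> N 1" "0 < row_sum \<alpha> N (N - 1)"
    using row_sum_nonneg(2)[OF \<alpha> _ _ N, of 1] row_sum_nonneg(2)[OF \<alpha> _ _ N, of "N - 1"] N
    by fastforce+
  moreover have "(2::real) powr (3 - \<alpha>) < 2 powr 2"
    using \<alpha> by (intro powr_less_mono) auto
  moreover have "8 - 2 * 2 powr (3 - \<alpha>) \<le> - 5 * bentry \<alpha> N e (e + 1)" if "e \<noteq> 0" "e + 1 \<noteq> N"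
    using bentry_offdiag_nonpos(2)[OF \<alpha>, of e N "e + 1"] that e by simp
  ultimately show ?thesis by (auto simp: edge_weight_def)
qed

text \<open>For inner edges the Toeplitz diagonal suffices, since midpoint defects only lower it.
  Boundary edges need the sharper diagonal bound that keeps the defect at 1.\<close>

lemma diag_le_edge_weight:
  assumes \<alpha>: "1 < \<alpha>" "\<alpha> < 2" and i: "1 \<le> i" "i < N" and N: "3 \<le> N"
  shows "bentry \<alpha> N i i \<le> 5 * edge_weight \<alpha> N i" "bentry \<alpha> N i i \<le> 5 * edge_weight \<alpha> N (i - 1)"
proof -
  have d: "bentry \<alpha> N i i = 8 - 2 * 2 powr (3 - \<alpha>)
      + mid_defect (3 - \<alpha>) (real i) + mid_defect (3 - \<alpha>) (real N - real i)"
    by (simp add: bentry_eq toep_0 btd_eq)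
  have m: "mid_defect (3 - \<alpha>) (real i) \<le> 0" "mid_defect (3 - \<alpha>) (real N - real i) \<le> 0"
    using i \<alpha> by (auto intro!: mid_defect_nonpos)
  \<comment> \<open>This cancels the powers of 2 in the Toeplitz diagonal, so the diagonal of a
    boundary row is at most \<open>8 - 4 * (3 - \<alpha>)\<close>, that is
    \<open>4 * (\<alpha> - 1)\<close>.\<close>
  have m1: "mid_defect (3 - \<alpha>) 1 = 2 * 2 powr (3 - \<alpha>) - 4 * (3 - \<alpha>)"
    by (simp add: mid_defect_def)
  have "(2::real) powr (2 - \<alpha>) \<le> 2 powr 1"
    using \<alpha> by (intro powr_mono) auto
  \<comment> \<open>Five times the row sum bound minus \<open>4 * (\<alpha> - 1)\<close>; hence
    \<open>11 = 5 * 3 - 4\<close>.\<close>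
  then have "0 \<le> (\<alpha> - 1) * (11 - 5 * 2 powr (2 - \<alpha>))"
    using \<alpha> by (intro mult_nonneg_nonneg) auto
  then have "8 - 4 * (3 - \<alpha>) \<le> 5 * ((\<alpha> - 1) * (3 - 2 powr (2 - \<alpha>)))"
    by (simp add: algebra_simps)
  then have bdry: "bentry \<alpha> N i i \<le> 5 * row_sum \<alpha> N i" if "i = 1 \<or> i = N - 1"
    using that row_sum_nonneg(2)[OF \<alpha> i N that] d m m1 i by (auto simp: of_nat_diff)
  have int: "bentry \<alpha> N i i \<le> 5 * edge_weight \<alpha> N e" if "e \<noteq> 0" "e + 1 < N" for e
    using bentry_offdiag_nonpos(2)[OF \<alpha>, of e N "e + 1"] that d m by (auto simp: edge_weight_def)
  show "bentry \<alpha> N i i \<le> 5 * edge_weight \<alpha> N i"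
  proof (cases "i = N - 1")
    case True then show ?thesis using bdry i by (auto simp: edge_weight_def)
  next
    case False then show ?thesis using int[of i] i by auto
  qed
  show "bentry \<alpha> N i i \<le> 5 * edge_weight \<alpha> N (i - 1)"
  proof (cases "i = 1")
    case True then show ?thesis using bdry by (auto simp: edge_weight_def)
  next
    case False then show ?thesis using int[of "i - 1"] i by auto
  qed
qed

section \<open>Energy estimates\<close>

text \<open>From 2ab = a^2 + b^2 - (a - b)^2: the Beurling-Deny split into row sums and
  increments.\<close>

lemma quadratic_form_by_differences:
  fixes m :: "nat \<Rightarrow> nat \<Rightarrow> real"
  assumes sym: "\<And>i j. m i j = m j i"
  shows "(\<Sum>i\<in>S. \<Sum>j\<in>S. m i j * x i * x j)
    = (\<Sum>i\<in>S. (\<Sum>j\<in>S. m i j) * (x i)\<^sup>2) - (\<Sum>i\<in>S. \<Sum>j\<in>S. m i j * (x i - x j)\<^sup>2) / 2"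
proof -
  have "(\<Sum>i\<in>S. \<Sum>j\<in>S. m i j * (x j)\<^sup>2) = (\<Sum>i\<in>S. \<Sum>j\<in>S. m i j * (x i)\<^sup>2)"
    by (subst sum.swap) (simp add: sym)
  moreover have "(\<Sum>i\<in>S. \<Sum>j\<in>S. m i j * (x i - x j)\<^sup>2) = (\<Sum>i\<in>S. \<Sum>j\<in>S. m i j * (x i)\<^sup>2)
      + (\<Sum>i\<in>S. \<Sum>j\<in>S. m i j * (x j)\<^sup>2) - 2 * (\<Sum>i\<in>S. \<Sum>j\<in>S. m i j * x i * x j)"
    unfolding sum_distrib_left sum.distrib[symmetric] sum_subtractf[symmetric]
    by (intro sum.cong refl) (simp add: power2_eq_square algebra_simps)
  ultimately show ?thesis by (simp add: sum_distrib_right diff_divide_distrib)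
qed

text \<open>Each edge occurs in the double sum in both orientations, hence the factor 1/2; all other
  pairs are dropped.\<close>

lemma sum_neighbours_le:
  fixes f :: "nat \<Rightarrow> nat \<Rightarrow> real"
  assumes "\<And>i j. 0 \<le> f i j" and sym: "\<And>i j. f i j = f j i"
  shows "(\<Sum>e\<in>{a..<n}. f e (Suc e)) \<le> (\<Sum>i\<in>{a..n}. \<Sum>j\<in>{a..n}. f i j) / 2"
proof -
  let ?P = "(\<lambda>e. (e, Suc e)) ` {a..<n}" and ?M = "(\<lambda>e. (Suc e, e)) ` {a..<n}"
  have "(\<Sum>e\<in>{a..<n}. f e (Suc e)) + (\<Sum>e\<in>{a..<n}. f (Suc e) e)
      = (\<Sum>(i,j)\<in>?P. f i j) + (\<Sum>(i,j)\<in>?M. f i j)"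
    by (subst (1 2) sum.reindex) (auto simp: inj_on_def)
  also have "\<dots> = (\<Sum>(i,j)\<in>?P \<union> ?M. f i j)"
    by (rule sum.union_disjoint[symmetric]) auto
  also have "\<dots> \<le> (\<Sum>(i,j)\<in>{a..n} \<times> {a..n}. f i j)"
    using assms(1) by (intro sum_mono2) auto
  also have "\<dots> = (\<Sum>i\<in>{a..n}. \<Sum>j\<in>{a..n}. f i j)"
    by (simp add: sum.cartesian_product)
  finally show ?thesis using sym by (simp add: field_simps)
qed

text \<open>In the split form, the signs of the off-diagonal entries allow dropping all but
  nearest-neighbour increments, and the signs of the row sums all but the first and the
  last.\<close>

lemma bentry_energy_ge:
  assumes \<alpha>: "1 < \<alpha>" "\<alpha> < 2" and N: "3 \<le> N" and bc: "x 0 = 0" "x N = 0"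
  shows "(\<Sum>e<N. edge_weight \<alpha> N e * (x (Suc e) - x e)\<^sup>2)
    \<le> (\<Sum>i\<in>{1..<N}. \<Sum>j\<in>{1..<N}. bentry \<alpha> N i j * x i * x j)"
proof -
  let ?S = "{1..<N}"
  \<comment> \<open>The cut-off makes \<open>f\<close> nonnegative and symmetric for all indices; on
    the diagonal the increment vanishes, whatever the sign of the entry.\<close>
  define f where "f i j = (if i \<in> ?S \<and> j \<in> ?S then - bentry \<alpha> N i j * (x i - x j)\<^sup>2 else 0)" for i j
  have S: "?S = {1..N - 1}" using N by auto
  have f: "f i j \<ge> 0" "f i j = f j i" for i j
  proof -
    show "f i j \<ge> 0"
      using bentry_offdiag_nonpos(1)[OF \<alpha>, of i N j]
      by (cases "i = j") (auto simp: f_def mult_nonpos_nonneg)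
    show "f i j = f j i"
      using bentry_sym[of \<alpha> N i j] by (auto simp: f_def power2_commute)
  qed
  have "(\<Sum>e\<in>{1..<N - 1}. edge_weight \<alpha> N e * (x (Suc e) - x e)\<^sup>2) = (\<Sum>e\<in>{1..<N - 1}. f e (Suc e))"
    by (intro sum.cong) (auto simp: f_def edge_weight_def power2_commute)
  also have "\<dots> \<le> (\<Sum>i\<in>?S. \<Sum>j\<in>?S. f i j) / 2"
    unfolding S by (rule sum_neighbours_le[OF f])
  also have "(\<Sum>i\<in>?S. \<Sum>j\<in>?S. f i j) = - (\<Sum>i\<in>?S. \<Sum>j\<in>?S. bentry \<alpha> N i j * (x i - x j)\<^sup>2)"
    by (simp add: f_def sum_negf)
  finally have inner: "(\<Sum>e\<in>{1..<N - 1}. edge_weight \<alpha> N e * (x (Suc e) - x e)\<^sup>2)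
      \<le> - (\<Sum>i\<in>?S. \<Sum>j\<in>?S. bentry \<alpha> N i j * (x i - x j)\<^sup>2) / 2" by simp
  \<comment> \<open>By the zero boundary values the boundary increments are \<open>x 1\<close> and
    \<open>- x (N - 1)\<close>.\<close>
  have "edge_weight \<alpha> N 0 * (x (Suc 0) - x 0)\<^sup>2 + edge_weight \<alpha> N (N - 1) * (x (Suc (N - 1)) - x (N - 1))\<^sup>2
      = (\<Sum>i\<in>{1, N - 1}. row_sum \<alpha> N i * (x i)\<^sup>2)"
    using N bc by (auto simp: edge_weight_def)
  also have "\<dots> \<le> (\<Sum>i\<in>?S. row_sum \<alpha> N i * (x i)\<^sup>2)"
    using N row_sum_nonneg(1)[OF \<alpha> _ _ N] by (intro sum_mono2) auto
  finally have outer: "edge_weight \<alpha> N 0 * (x (Suc 0) - x 0)\<^sup>2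
      + edge_weight \<alpha> N (N - 1) * (x (Suc (N - 1)) - x (N - 1))\<^sup>2
      \<le> (\<Sum>i\<in>?S. row_sum \<alpha> N i * (x i)\<^sup>2)" .
  have "{..<N} = insert 0 (insert (N - 1) {1..<N - 1})" using N by auto
  then have "(\<Sum>e<N. edge_weight \<alpha> N e * (x (Suc e) - x e)\<^sup>2)
      = edge_weight \<alpha> N 0 * (x (Suc 0) - x 0)\<^sup>2 + edge_weight \<alpha> N (N - 1) * (x (Suc (N - 1)) - x (N - 1))\<^sup>2
       + (\<Sum>e\<in>{1..<N - 1}. edge_weight \<alpha> N e * (x (Suc e) - x e)\<^sup>2)"
    using N by simp
  also have "\<dots> \<le> (\<Sum>i\<in>?S. row_sum \<alpha> N i * (x i)\<^sup>2) - (\<Sum>i\<in>?S. \<Sum>j\<in>?S. bentry \<alpha> N i j * (x i - x j)\<^sup>2) / 2"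
    using inner outer by simp
  also have "\<dots> = (\<Sum>i\<in>?S. \<Sum>j\<in>?S. bentry \<alpha> N i j * x i * x j)"
    unfolding row_sum_def by (rule quadratic_form_by_differences[symmetric]) (rule bentry_sym)
  finally show ?thesis .
qed

text \<open>If every increment vanished, \<open>x\<close> would be constant and equal to its
  boundary value 0.\<close>

lemma bentry_form_pos:
  assumes \<alpha>: "1 < \<alpha>" "\<alpha> < 2" and N: "3 \<le> N" and bc: "x 0 = 0" "x N = 0" and nz: "k < N" "x k \<noteq> 0"
  shows "0 < (\<Sum>i\<in>{1..<N}. \<Sum>j\<in>{1..<N}. bentry \<alpha> N i j * x i * x j)"
proof -
  have "\<exists>e<N. x (Suc e) \<noteq> x e"
  proof (rule ccontr)
    assume "\<not> ?thesis"
    then have "x e = 0" if "e \<le> N" for e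
      using that by (induction e) (auto simp: bc)
    with nz show False by auto
  qed
  then obtain e where e: "e < N" "x (Suc e) \<noteq> x e" by blast
  have "0 < edge_weight \<alpha> N e * (x (Suc e) - x e)\<^sup>2"
    using e edge_weight_pos[OF \<alpha> e(1) N] by simp
  also have "\<dots> \<le> (\<Sum>e<N. edge_weight \<alpha> N e * (x (Suc e) - x e)\<^sup>2)"
    using e edge_weight_pos[OF \<alpha> _ N] by (intro member_le_sum mult_nonneg_nonneg) (auto intro: less_imp_le)
  also note bentry_energy_ge[OF \<alpha> N bc]
  finally show ?thesis .
qed

text \<open>The entry is the value of the form at the indicator of \<open>k\<close>.\<close>

lemma bentry_diag_pos:
  assumes \<alpha>: "1 < \<alpha>" "\<alpha> < 2" and N: "3 \<le> N" and k: "1 \<le> k" "k < N"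
  shows "0 < bentry \<alpha> N k k"
proof -
  have "0 < (\<Sum>i\<in>{1..<N}. \<Sum>j\<in>{1..<N}. bentry \<alpha> N i j * (if i = k then 1 else 0) * (if j = k then 1 else 0))"
    using k by (intro bentry_form_pos[OF \<alpha> N, of _ k]) auto
  then show ?thesis using k
    by (simp add: if_distrib[of "\<lambda>t. _ * t"] sum.delta cong: if_cong)
qed

text \<open>The error at an odd node is half the difference of the two adjacent increments, and ((a
  - c) / 2)^2 \<le> (a^2 + c^2) / 2. With the factor 5 from \<open>diag_le_edge_weight\<close> this
  gives 5/2; the edges \<open>2 * k\<close> and \<open>2 * k + 1\<close> exhaust all edges
  once.\<close>

lemma interpolation_error_le:
  assumes \<alpha>: "1 < \<alpha>" "\<alpha> < 2" and N: "N = 2 * M" "2 \<le> M" and bc: "x 0 = 0" "x N = 0"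
  shows "(\<Sum>k<M. bentry \<alpha> N (2 * k + 1) (2 * k + 1) * (x (2 * k + 1) - (x (2 * k) + x (2 * k + 2)) / 2)\<^sup>2)
    \<le> 5 / 2 * (\<Sum>i\<in>{1..<N}. \<Sum>j\<in>{1..<N}. bentry \<alpha> N i j * x i * x j)"
proof -
  let ?g = "\<lambda>e. edge_weight \<alpha> N e * (x (Suc e) - x e)\<^sup>2"
  have N3: "3 \<le> N" using N by simp
  have step: "bentry \<alpha> N (2 * k + 1) (2 * k + 1) * (x (2 * k + 1) - (x (2 * k) + x (2 * k + 2)) / 2)\<^sup>2
      \<le> 5 / 2 * (?g (2 * k) + ?g (2 * k + 1))" if "k < M" for k
  proof -
    define d where "d = bentry \<alpha> N (2 * k + 1) (2 * k + 1)"
    define a where "a = x (2 * k + 1) - x (2 * k)"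
    define c where "c = x (2 * k + 2) - x (2 * k + 1)"
    have d: "d \<le> 5 * edge_weight \<alpha> N (2 * k + 1)" "d \<le> 5 * edge_weight \<alpha> N (2 * k)"
      using diag_le_edge_weight[OF \<alpha>, of "2 * k + 1" N] that N by (auto simp: d_def)
    have d0: "0 < d" unfolding d_def using that N by (intro bentry_diag_pos[OF \<alpha> N3]) auto
    have "d * (x (2 * k + 1) - (x (2 * k) + x (2 * k + 2)) / 2)\<^sup>2 = d * ((a - c) / 2)\<^sup>2"
      by (simp add: a_def c_def field_simps)
    also have "\<dots> \<le> d * ((a\<^sup>2 + c\<^sup>2) / 2)"
      using d0 zero_le_power2[of "a + c"]
      by (intro mult_left_mono) (auto simp: power2_eq_square field_simps)
    also have "\<dots> = (d * a\<^sup>2 + d * c\<^sup>2) / 2" by (simp add: algebra_simps)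
    also have "\<dots> \<le> (5 * edge_weight \<alpha> N (2 * k) * a\<^sup>2 + 5 * edge_weight \<alpha> N (2 * k + 1) * c\<^sup>2) / 2"
      using d by (intro divide_right_mono add_mono mult_right_mono) auto
    finally show ?thesis by (simp add: d_def a_def c_def algebra_simps)
  qed
  have "(\<Sum>k<M. bentry \<alpha> N (2 * k + 1) (2 * k + 1) * (x (2 * k + 1) - (x (2 * k) + x (2 * k + 2)) / 2)\<^sup>2)
      \<le> (\<Sum>k<M. 5 / 2 * (?g (2 * k) + ?g (2 * k + 1)))"
    by (intro sum_mono step) auto
  also have "\<dots> = 5 / 2 * (\<Sum>k<M. ?g (2 * k) + ?g (2 * k + 1))"
    by (rule sum_distrib_left[symmetric])
  also have "(\<Sum>k<M. ?g (2 * k) + ?g (2 * k + 1)) = (\<Sum>e<2 * M. ?g e)"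
    by (induction M) simp_all
  also have "5 / 2 * \<dots> \<le> 5 / 2 * (\<Sum>i\<in>{1..<N}. \<Sum>j\<in>{1..<N}. bentry \<alpha> N i j * x i * x j)"
    using bentry_energy_ge[where x = x, OF \<alpha> N3 bc] N by (intro mult_left_mono) auto
  finally show ?thesis .
qed

section \<open>Quadratic forms and the Rayleigh bound\<close>

lemma scalar_prod_self_eq: "(v :: real vec) \<bullet> v = (\<Sum>i<dim_vec v. (v $ i)\<^sup>2)"
  by (simp add: scalar_prod_def power2_eq_square lessThan_atLeast0)

lemma scalar_prod_self_nonneg: "0 \<le> (v :: real vec) \<bullet> v"
  by (simp add: scalar_prod_self_eq sum_nonneg)

lemma scalar_prod_self_0_iff:
  assumes "(v :: real vec) \<in> carrier_vec n"
  shows "v \<bullet> v = 0 \<longleftrightarrow> v = 0\<^sub>v n"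
  using assms by (subst scalar_prod_self_eq) (auto simp: sum_nonneg_eq_0_iff intro!: eq_vecI)

lemma form_eq_sum:
  assumes "A \<in> carrier_mat n n" "(v :: real vec) \<in> carrier_vec n" "w \<in> carrier_vec n"
  shows "v \<bullet> (A *\<^sub>v w) = (\<Sum>i<n. \<Sum>j<n. A $$ (i, j) * v $ i * w $ j)"
  using assms by (auto simp: scalar_prod_def lessThan_atLeast0 sum_distrib_left intro!: sum.cong)

lemma diag_form_eq_sum:
  assumes "(v :: real vec) \<in> carrier_vec n"
  shows "v \<bullet> (mat_diag n d *\<^sub>v v) = (\<Sum>i<n. d i * (v $ i)\<^sup>2)"
proof -
  have "v \<bullet> (mat_diag n d *\<^sub>v v) = (\<Sum>i<n. \<Sum>j<n. mat_diag n d $$ (i, j) * v $ i * v $ j)"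
    using assms by (intro form_eq_sum) auto
  also have "\<dots> = (\<Sum>i<n. \<Sum>j<n. if j = i then d i * (v $ i)\<^sup>2 else 0)"
    by (intro sum.cong) (auto simp: mat_diag_def power2_eq_square)
  finally show ?thesis by simp
qed

lemma mat_diag_mult_vec:
  assumes "(v :: real vec) \<in> carrier_vec n" "i < n"
  shows "(mat_diag n d *\<^sub>v v) $ i = d i * v $ i"
proof -
  have "(mat_diag n d *\<^sub>v v) $ i = (\<Sum>j<n. mat_diag n d $$ (i, j) * v $ j)"
    using assms by (auto simp: scalar_prod_def lessThan_atLeast0 mat_diag_def intro!: sum.cong)
  also have "\<dots> = (\<Sum>j<n. if j = i then d i * v $ i else 0)"
    using assms by (intro sum.cong) (auto simp: mat_diag_def)
  finally show ?thesis using assms by simp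
qed

lemma smult_mat_mult_vec:
  fixes A :: "real mat"
  assumes "A \<in> carrier_mat nr nc" "v \<in> carrier_vec nc"
  shows "(k \<cdot>\<^sub>m A) *\<^sub>v v = k \<cdot>\<^sub>v (A *\<^sub>v v)"
  using assms by (intro eq_vecI) (auto simp: scalar_prod_def sum_distrib_left mult.assoc)

lemma symmetric_form_commute:
  assumes "(A :: real mat) \<in> carrier_mat n n" "A\<^sup>T = A" "x \<in> carrier_vec n" "y \<in> carrier_vec n"
  shows "x \<bullet> (A *\<^sub>v y) = y \<bullet> (A *\<^sub>v x)"
proof -
  have "x \<bullet> (A *\<^sub>v y) = (A *\<^sub>v x) \<bullet> y"
    using transpose_vec_mult_scalar[OF assms(1,4,3)] assms(2) by simp
  also have "\<dots> = y \<bullet> (A *\<^sub>v x)"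
    using assms by (intro comm_scalar_prod[of _ n]) auto
  finally show ?thesis .
qed

lemma form_diff:
  assumes A: "(A :: real mat) \<in> carrier_mat n n" "A\<^sup>T = A" and x: "x \<in> carrier_vec n" and y: "y \<in> carrier_vec n"
  shows "(x - y) \<bullet> (A *\<^sub>v (x - y)) = x \<bullet> (A *\<^sub>v x) - 2 * (y \<bullet> (A *\<^sub>v x)) + y \<bullet> (A *\<^sub>v y)"
proof -
  have Ax: "A *\<^sub>v x \<in> carrier_vec n" and Ay: "A *\<^sub>v y \<in> carrier_vec n" using A x y by auto
  show ?thesis
    unfolding mult_minus_distrib_mat_vec[OF A(1) x y]
      minus_scalar_prod_distrib[OF x y minus_carrier_vec[OF Ax Ay]]
      scalar_prod_minus_distrib[OF x Ax Ay] scalar_prod_minus_distrib[OF y Ax Ay]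
      symmetric_form_commute[OF A x y] by simp
qed

lemma scalar_prod_le_half_squares:
  assumes "(v :: real vec) \<in> carrier_vec n" "w \<in> carrier_vec n"
  shows "v \<bullet> w \<le> (v \<bullet> v + w \<bullet> w) / 2"
proof -
  have "(\<Sum>i<n. v $ i * w $ i) \<le> (\<Sum>i<n. ((v $ i)\<^sup>2 + (w $ i)\<^sup>2) / 2)"
    by (intro sum_mono) (use sum_squares_bound in \<open>auto simp: field_simps\<close>)
  also have "\<dots> = (v \<bullet> v + w \<bullet> w) / 2"
    using assms by (simp add: scalar_prod_self_eq sum.distrib flip: sum_divide_distrib)
  finally show ?thesis using assms by (simp add: scalar_prod_def lessThan_atLeast0)
qed

section \<open>Boundedness, coercivity and the largest eigenvalue\<close>

lemma mat_vec_bounded: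
  assumes A: "(A :: real mat) \<in> carrier_mat n n"
  obtains L where "0 < L" "\<And>v. v \<in> carrier_vec n \<Longrightarrow> (A *\<^sub>v v) \<bullet> (A *\<^sub>v v) \<le> L * (v \<bullet> v)"
proof
  \<comment> \<open>The squared Frobenius norm; the added 1 keeps it positive for the zero
    matrix.\<close>
  define L where "L = 1 + (\<Sum>i<n. \<Sum>j<n. (A $$ (i, j))\<^sup>2)"
  show "0 < L" unfolding L_def by (intro add_pos_nonneg sum_nonneg) auto
  fix v :: "real vec" assume v: "v \<in> carrier_vec n"
  have "(A *\<^sub>v v) \<bullet> (A *\<^sub>v v) = (\<Sum>i<n. (\<Sum>j<n. A $$ (i, j) * v $ j)\<^sup>2)"
    unfolding scalar_prod_self_eq using A v
    by (auto simp: scalar_prod_def lessThan_atLeast0 intro!: sum.cong arg_cong[of _ _ "\<lambda>t. t\<^sup>2"])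
  also have "\<dots> \<le> (\<Sum>i<n. (\<Sum>j<n. (A $$ (i, j))\<^sup>2) * (\<Sum>j<n. (v $ j)\<^sup>2))"
    by (intro sum_mono Cauchy_Schwarz_ineq_sum)
  also have "\<dots> = (L - 1) * (v \<bullet> v)"
    using v by (simp add: L_def scalar_prod_self_eq sum_distrib_right)
  also have "\<dots> \<le> L * (v \<bullet> v)"
    using scalar_prod_self_nonneg by (intro mult_right_mono) auto
  finally show "(A *\<^sub>v v) \<bullet> (A *\<^sub>v v) \<le> L * (v \<bullet> v)" .
qed

lemma form_bounded:
  assumes A: "(A :: real mat) \<in> carrier_mat n n"
  obtains L where "0 < L" "\<And>v. v \<in> carrier_vec n \<Longrightarrow> v \<bullet> (A *\<^sub>v v) \<le> L * (v \<bullet> v)"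
proof -
  obtain L where L: "0 < L" "\<And>v. v \<in> carrier_vec n \<Longrightarrow> (A *\<^sub>v v) \<bullet> (A *\<^sub>v v) \<le> L * (v \<bullet> v)"
    using mat_vec_bounded[OF A] by blast
  show ?thesis
  proof
    show "0 < (1 + L) / 2" using L(1) by simp
    fix v :: "real vec" assume v: "v \<in> carrier_vec n"
    have "v \<bullet> (A *\<^sub>v v) \<le> (v \<bullet> v + (A *\<^sub>v v) \<bullet> (A *\<^sub>v v)) / 2"
      using A v by (intro scalar_prod_le_half_squares[of _ n]) auto
    with L(2)[OF v] show "v \<bullet> (A *\<^sub>v v) \<le> (1 + L) / 2 * (v \<bullet> v)"
      by (simp add: algebra_simps add_divide_distrib)
  qed
qed

text \<open>Semidefiniteness tested at v - Mv / L gives |Mv|^2 \<le> L (v, Mv), and invertibility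
  gives |v|^2 \<le> K |Mv|^2; so \<delta> = 1 / (K L) works.\<close>

lemma psd_nonsingular_coercive:
  assumes M: "(M :: real mat) \<in> carrier_mat n n" "M\<^sup>T = M" and det: "det M \<noteq> 0"
    and psd: "\<And>v. v \<in> carrier_vec n \<Longrightarrow> 0 \<le> v \<bullet> (M *\<^sub>v v)"
  obtains \<delta> where "0 < \<delta>" "\<And>v. v \<in> carrier_vec n \<Longrightarrow> \<delta> * (v \<bullet> v) \<le> v \<bullet> (M *\<^sub>v v)"
proof -
  obtain L where L: "0 < L" "\<And>v. v \<in> carrier_vec n \<Longrightarrow> v \<bullet> (M *\<^sub>v v) \<le> L * (v \<bullet> v)"
    using form_bounded[OF M(1)] by blast
  obtain X where X: "X \<in> carrier_mat n n" "X * M = 1\<^sub>m n"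
    using det_non_zero_imp_unit[OF M(1) det, of "()"] by (auto simp: Units_def ring_mat_def)
  obtain K where K: "0 < K" "\<And>v. v \<in> carrier_vec n \<Longrightarrow> (X *\<^sub>v v) \<bullet> (X *\<^sub>v v) \<le> K * (v \<bullet> v)"
    using mat_vec_bounded[OF X(1)] by blast
  show ?thesis
  proof
    show "0 < 1 / (K * L)" using K(1) L(1) by simp
    fix v :: "real vec" assume v: "v \<in> carrier_vec n"
    define u where "u = M *\<^sub>v v"
    have u: "u \<in> carrier_vec n" using M v by (simp add: u_def)
    have "X *\<^sub>v u = v"
      unfolding u_def using assoc_mult_mat_vec[OF X(1) M(1) v, symmetric] X(2) v by simp
    then have 1: "v \<bullet> v \<le> K * (u \<bullet> u)" using K(2)[OF u] by simp
    have "0 \<le> (v - (1 / L) \<cdot>\<^sub>v u) \<bullet> (M *\<^sub>v (v - (1 / L) \<cdot>\<^sub>v u))"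
      using u v by (intro psd) auto
    also have "\<dots> = v \<bullet> u - 2 * (1 / L * (u \<bullet> u)) + 1 / L * (1 / L * (u \<bullet> (M *\<^sub>v u)))"
      using u v M(1) by (subst form_diff[OF M]) (auto simp: u_def mult_mat_vec)
    also have "\<dots> \<le> v \<bullet> u - 2 * (1 / L * (u \<bullet> u)) + 1 / L * (1 / L * (L * (u \<bullet> u)))"
      using L u by (intro add_left_mono mult_left_mono) auto
    also have "\<dots> = v \<bullet> u - (u \<bullet> u) / L" using L(1) by (simp add: field_simps)
    finally have "u \<bullet> u \<le> L * (v \<bullet> u)" using L(1) by (simp add: field_simps)
    then have "v \<bullet> v \<le> K * (L * (v \<bullet> u))"
      using 1 K(1) by (meson mult_left_mono order_trans less_imp_le)
    then show "1 / (K * L) * (v \<bullet> v) \<le> v \<bullet> (M *\<^sub>v v)"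
      using K(1) L(1) by (simp add: u_def field_simps)
  qed
qed

text \<open>The infimum of all \<open>t\<close> for which \<open>t D - A\<close> is positive semidefinite is attained, and there
  \<open>t D - A\<close> must be singular: otherwise it would be coercive and \<open>t\<close> could be lowered.\<close>
lemma form_le_max_eigenvalue:
  assumes A: "(A :: real mat) \<in> carrier_mat n n" "A\<^sup>T = A" and n: "0 < n"
    and d: "\<And>i. i < n \<Longrightarrow> 0 < d i"
    and ev: "\<And>ev. eigenvalue (mat_diag n (\<lambda>i. 1 / d i) * A) ev \<Longrightarrow> ev \<le> \<eta>"
    and v: "v \<in> carrier_vec n"
  shows "v \<bullet> (A *\<^sub>v v) \<le> \<eta> * (v \<bullet> (mat_diag n d *\<^sub>v v))"
proof -
  let ?D = "mat_diag n d"
  define S where "S = {t. \<forall>v \<in> carrier_vec n. v \<bullet> (A *\<^sub>v v) \<le> t * (v \<bullet> (?D *\<^sub>v v))}"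
  define dmin where "dmin = Min (d ` {..<n})"
  define dmax where "dmax = Max (d ` {..<n})"
  have dmin: "0 < dmin" "\<And>i. i < n \<Longrightarrow> dmin \<le> d i" and dmax: "0 < dmax" "\<And>i. i < n \<Longrightarrow> d i \<le> dmax"
  proof -
    have "dmin \<in> d ` {..<n}" "dmax \<in> d ` {..<n}" unfolding dmin_def dmax_def using n by (auto intro!: Min_in Max_in)
    then show "0 < dmin" "0 < dmax" using d by auto
  qed (auto simp: dmin_def dmax_def)
  have Dge: "dmin * (v \<bullet> v) \<le> v \<bullet> (?D *\<^sub>v v)" and Dle: "v \<bullet> (?D *\<^sub>v v) \<le> dmax * (v \<bullet> v)"
    if "v \<in> carrier_vec n" for v
    using that dmin dmax unfolding diag_form_eq_sum[OF that] scalar_prod_self_eq sum_distrib_left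
    by (auto intro!: sum_mono mult_right_mono)
  obtain L where L: "0 < L" "\<And>v. v \<in> carrier_vec n \<Longrightarrow> v \<bullet> (A *\<^sub>v v) \<le> L * (v \<bullet> v)"
    using form_bounded[OF A(1)] by blast
  have "L / dmin \<in> S"
    unfolding S_def
  proof safe
    fix v :: "real vec" assume v: "v \<in> carrier_vec n"
    have "L * (v \<bullet> v) = L / dmin * (dmin * (v \<bullet> v))" using dmin(1) by simp
    also have "\<dots> \<le> L / dmin * (v \<bullet> (?D *\<^sub>v v))"
      using Dge[OF v] L(1) dmin(1) by (intro mult_left_mono) auto
    finally show "v \<bullet> (A *\<^sub>v v) \<le> L / dmin * (v \<bullet> (?D *\<^sub>v v))" using L(2)[OF v] by simp
  qed
  then have S_ne: "S \<noteq> {}" by auto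
  have Rayleigh_le: "v \<bullet> (A *\<^sub>v v) / (v \<bullet> (?D *\<^sub>v v)) \<le> t"
    if "t \<in> S" "v \<in> carrier_vec n" "0 < v \<bullet> (?D *\<^sub>v v)" for v t
    using that by (auto simp: S_def divide_le_eq)
  have Dpos: "0 < v \<bullet> (?D *\<^sub>v v)" if "v \<in> carrier_vec n" "v \<noteq> 0\<^sub>v n" for v
  proof -
    have "0 < v \<bullet> v" using that scalar_prod_self_0_iff[of v n] scalar_prod_self_nonneg[of v] by linarith
    then show ?thesis using Dge[OF that(1)] dmin(1) by (meson mult_pos_pos order_less_le_trans)
  qed
  \<comment> \<open>A nonzero vector, whose Rayleigh quotient bounds \<open>S\<close> from
    below.\<close>
  have unit: "unit_vec n 0 \<in> carrier_vec n" "unit_vec n 0 \<noteq> (0\<^sub>v n :: real vec)" using n by auto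
  have bdd: "bdd_below S"
    using Rayleigh_le[OF _ unit(1) Dpos[OF unit]] by (auto simp: bdd_below_def)
  define t where "t = Inf S"
  \<comment> \<open>Every Rayleigh quotient is a lower bound of \<open>S\<close>, hence at most its
    infimum.\<close>
  have tS: "t \<in> S"
    unfolding S_def
  proof safe
    fix v :: "real vec" assume v: "v \<in> carrier_vec n"
    show "v \<bullet> (A *\<^sub>v v) \<le> t * (v \<bullet> (?D *\<^sub>v v))"
    proof (cases "v = 0\<^sub>v n")
      case True then show ?thesis using A by (simp add: scalar_prod_def)
    next
      case False
      have "v \<bullet> (A *\<^sub>v v) / (v \<bullet> (?D *\<^sub>v v)) \<le> t"
        unfolding t_def by (intro cInf_greatest S_ne Rayleigh_le v Dpos False)
      then show ?thesis using Dpos[OF v False] by (simp add: divide_le_eq)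
    qed
  qed
  define M where "M = t \<cdot>\<^sub>m ?D - A"
  have M: "M \<in> carrier_mat n n" unfolding M_def using A(1) by (rule minus_carrier_mat)
  have Mv: "M *\<^sub>v v = t \<cdot>\<^sub>v (?D *\<^sub>v v) - A *\<^sub>v v" if "v \<in> carrier_vec n" for v
    unfolding M_def using A(1) that
    by (subst minus_mult_distrib_mat_vec[of _ n n]) (auto simp: smult_mat_mult_vec[of _ n n])
  have form: "v \<bullet> (M *\<^sub>v v) = t * (v \<bullet> (?D *\<^sub>v v)) - v \<bullet> (A *\<^sub>v v)" if "v \<in> carrier_vec n" for v
    unfolding Mv[OF that] using A(1) that
    by (subst scalar_prod_minus_distrib[of _ n]) (auto intro!: mult_mat_vec_carrier[of _ n n] scalar_prod_smult_distrib[of _ n])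
  have Msym: "M\<^sup>T = M"
  proof (rule eq_matI)
    fix i j assume ij: "i < dim_row M" "j < dim_col M"
    have "A $$ (j, i) = A $$ (i, j)"
      using A ij M by (metis carrier_matD index_transpose_mat(1))
    then show "M\<^sup>T $$ (i, j) = M $$ (i, j)"
      using A(1) ij M by (auto simp: M_def mat_diag_def)
  qed (use M in auto)
  have "det M = 0"
  proof (rule ccontr)
    assume "det M \<noteq> 0"
    moreover have "0 \<le> v \<bullet> (M *\<^sub>v v)" if "v \<in> carrier_vec n" for v
      using tS that by (simp add: S_def form)
    ultimately obtain \<delta> where \<delta>: "0 < \<delta>" "\<And>v. v \<in> carrier_vec n \<Longrightarrow> \<delta> * (v \<bullet> v) \<le> v \<bullet> (M *\<^sub>v v)"
      using psd_nonsingular_coercive[OF M Msym] by blast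
    \<comment> \<open>Coercivity leaves a slack of \<delta> |v|^2, which \<open>dmax\<close>
      converts into a multiple of the form of \<open>?D\<close>.\<close>
    have "t - \<delta> / dmax \<in> S"
      unfolding S_def
    proof safe
      fix v :: "real vec" assume v: "v \<in> carrier_vec n"
      have "\<delta> / dmax * (v \<bullet> (?D *\<^sub>v v)) \<le> \<delta> / dmax * (dmax * (v \<bullet> v))"
        using Dle[OF v] \<delta>(1) dmax(1) by (intro mult_left_mono) auto
      also have "\<dots> = \<delta> * (v \<bullet> v)" using dmax(1) by simp
      also have "\<dots> \<le> t * (v \<bullet> (?D *\<^sub>v v)) - v \<bullet> (A *\<^sub>v v)" using \<delta>(2)[OF v] form[OF v] by simp
      finally show "v \<bullet> (A *\<^sub>v v) \<le> (t - \<delta> / dmax) * (v \<bullet> (?D *\<^sub>v v))"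
        by (simp add: left_diff_distrib)
    qed
    then have "t \<le> t - \<delta> / dmax" unfolding t_def using bdd by (intro cInf_lower)
    then show False using \<delta>(1) dmax(1) by (simp add: field_simps)
  qed
  then obtain z where z: "z \<in> carrier_vec n" "z \<noteq> 0\<^sub>v n" "M *\<^sub>v z = 0\<^sub>v n"
    using det_0_iff_vec_prod_zero_field[OF M] by blast
  \<comment> \<open>The kernel equation says A z = t D z, so \<open>t\<close> is an eigenvalue and
    falls under \<open>ev\<close>.\<close>
  have "eigenvector (mat_diag n (\<lambda>i. 1 / d i) * A) z t"
    unfolding eigenvector_def
  proof (intro conjI)
    show "(mat_diag n (\<lambda>i. 1 / d i) * A) *\<^sub>v z = t \<cdot>\<^sub>v z"
    proof (rule eq_vecI)
      fix i assume "i < dim_vec (t \<cdot>\<^sub>v z)"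
      then have i: "i < n" using z by simp
      have "(t \<cdot>\<^sub>v (?D *\<^sub>v z) - A *\<^sub>v z) $ i = 0" using z(3) Mv[OF z(1)] i by simp
      then have Az: "(A *\<^sub>v z) $ i = t * (d i * z $ i)"
        using i A(1) z(1) mat_diag_mult_vec[OF z(1) i, of d] by (simp add: mat_diag_def)
      have "((mat_diag n (\<lambda>i. 1 / d i) * A) *\<^sub>v z) $ i = (mat_diag n (\<lambda>i. 1 / d i) *\<^sub>v (A *\<^sub>v z)) $ i"
        using A(1) z(1) by (subst assoc_mult_mat_vec[of _ n n]) auto
      also have "\<dots> = 1 / d i * (A *\<^sub>v z) $ i"
        using A(1) z(1) i by (intro mat_diag_mult_vec) auto
      finally show "((mat_diag n (\<lambda>i. 1 / d i) * A) *\<^sub>v z) $ i = (t \<cdot>\<^sub>v z) $ i"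
        using Az d[OF i] i z(1) by simp
    qed (use A z in \<open>auto simp: mat_diag_def\<close>)
  qed (use A z in \<open>auto simp: mat_diag_def\<close>)
  then have "t \<le> \<eta>" using ev by (auto simp: eigenvalue_def)
  have "v \<bullet> (A *\<^sub>v v) \<le> t * (v \<bullet> (?D *\<^sub>v v))" using tS v by (simp add: S_def)
  also have "\<dots> \<le> \<eta> * (v \<bullet> (?D *\<^sub>v v))"
    using \<open>t \<le> \<eta>\<close> Dge[OF v] mult_nonneg_nonneg[OF less_imp_le[OF dmin(1)] scalar_prod_self_nonneg[of v]]
    by (intro mult_right_mono) linarith+
  finally show ?thesis .
qed

section \<open>Smoothing and coarse grid correction\<close>

lemma vnorm_square: "0 \<le> v \<bullet> (M *\<^sub>v v) \<Longrightarrow> (vnorm M v)\<^sup>2 = v \<bullet> (M *\<^sub>v v)"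
  by (simp add: vnorm_def)

text \<open>The smoothed energy is quadratic in \<omega>. Its linear coefficient is -2 times the
  squared residual norm in the inverse diagonal; the Rayleigh bound, applied to the preconditioned
  residual, bounds the quadratic coefficient by \<open>\<eta>\<^sub>0\<close> times the same
  norm.\<close>

lemma jacobi_smoothing:
  assumes A: "(A :: real mat) \<in> carrier_mat n n" "A\<^sup>T = A" and n: "0 < n"
    and d: "\<And>i. i < n \<Longrightarrow> 0 < A $$ (i, i)"
    and ev: "\<And>ev. eigenvalue (diag_inv A * A) ev \<Longrightarrow> ev \<le> \<eta>\<^sub>0"
    and \<eta>: "\<eta> \<le> \<omega> * (2 - \<omega> * \<eta>\<^sub>0)"
    and v: "v \<in> carrier_vec n"
  shows "(jacobi \<omega> A *\<^sub>v v) \<bullet> (A *\<^sub>v (jacobi \<omega> A *\<^sub>v v))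
    \<le> v \<bullet> (A *\<^sub>v v) - \<eta> * ((A *\<^sub>v v) \<bullet> (diag_inv A *\<^sub>v (A *\<^sub>v v)))"
proof -
  have di: "diag_inv A = mat_diag n (\<lambda>i. 1 / A $$ (i, i))" using A by (simp add: diag_inv_def)
  have dc: "diag_inv A \<in> carrier_mat n n" by (simp add: di)
  define a where "a = A *\<^sub>v v"
  define u where "u = diag_inv A *\<^sub>v a"
  have a: "a \<in> carrier_vec n" using A v by (simp add: a_def)
  have u: "u \<in> carrier_vec n" using dc a by (simp add: u_def)
  have J: "jacobi \<omega> A *\<^sub>v v = v - \<omega> \<cdot>\<^sub>v u"
  proof -
    have "(\<omega> \<cdot>\<^sub>m (diag_inv A * A)) *\<^sub>v v = \<omega> \<cdot>\<^sub>v ((diag_inv A * A) *\<^sub>v v)"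
      using A v dc by (intro smult_mat_mult_vec[of _ n n]) auto
    also have "(diag_inv A * A) *\<^sub>v v = u"
      using A v dc by (simp add: u_def a_def)
    moreover have "jacobi \<omega> A *\<^sub>v v = 1\<^sub>m n *\<^sub>v v - (\<omega> \<cdot>\<^sub>m (diag_inv A * A)) *\<^sub>v v"
      unfolding jacobi_def using A v dc by (subst minus_mult_distrib_mat_vec[of _ n n]) auto
    ultimately show ?thesis using v by simp
  qed
  have ui: "u $ i = a $ i / A $$ (i, i)" if "i < n" for i
    using mat_diag_mult_vec[OF a that] by (simp add: u_def di)
  have Xs: "a \<bullet> (diag_inv A *\<^sub>v a) = (\<Sum>i<n. 1 / A $$ (i, i) * (a $ i)\<^sup>2)"
    unfolding di by (rule diag_form_eq_sum[OF a])
  have X0: "0 \<le> a \<bullet> (diag_inv A *\<^sub>v a)"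
    unfolding Xs using d by (auto intro!: sum_nonneg simp: less_imp_le)
  have "u \<bullet> (A *\<^sub>v u) \<le> \<eta>\<^sub>0 * (u \<bullet> (mat_diag n (\<lambda>i. A $$ (i, i)) *\<^sub>v u))"
    using ev d by (intro form_le_max_eigenvalue[OF A n _ _ u]) (auto simp: di)
  also have "u \<bullet> (mat_diag n (\<lambda>i. A $$ (i, i)) *\<^sub>v u) = a \<bullet> (diag_inv A *\<^sub>v a)"
    unfolding Xs diag_form_eq_sum[OF u]
  proof (intro sum.cong refl)
    fix i assume "i \<in> {..<n}"
    then show "A $$ (i, i) * (u $ i)\<^sup>2 = 1 / A $$ (i, i) * (a $ i)\<^sup>2"
      using d[of i] ui[of i] by (simp add: power2_eq_square)
  qed
  finally have uAu: "\<omega>\<^sup>2 * (u \<bullet> (A *\<^sub>v u)) \<le> \<omega>\<^sup>2 * (\<eta>\<^sub>0 * (a \<bullet> (diag_inv A *\<^sub>v a)))"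
    by (intro mult_left_mono) auto
  have ua: "u \<bullet> a = a \<bullet> (diag_inv A *\<^sub>v a)"
    using comm_scalar_prod[OF u a] by (simp add: u_def)
  have "(v - \<omega> \<cdot>\<^sub>v u) \<bullet> (A *\<^sub>v (v - \<omega> \<cdot>\<^sub>v u)) = v \<bullet> a - 2 * \<omega> * (u \<bullet> a) + \<omega>\<^sup>2 * (u \<bullet> (A *\<^sub>v u))"
    using u a v A(1) by (subst form_diff[OF A]) (auto simp: a_def mult_mat_vec power2_eq_square)
  also have "\<dots> \<le> v \<bullet> a - \<omega> * (2 - \<omega> * \<eta>\<^sub>0) * (a \<bullet> (diag_inv A *\<^sub>v a))"
    using uAu unfolding ua by (simp add: algebra_simps power2_eq_square)
  also have "\<dots> \<le> v \<bullet> a - \<eta> * (a \<bullet> (diag_inv A *\<^sub>v a))"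
    using mult_right_mono[OF \<eta> X0] by simp
  finally show ?thesis unfolding J a_def .
qed

text \<open>A kernel vector of the coarse matrix would have a nonzero prolongation of zero energy.
  Hence \<open>mat_inverse\<close> returns \<open>Some\<close> and \<open>the\<close> is
  meaningful.\<close>

lemma coarse_inverse:
  assumes A: "(A :: real mat) \<in> carrier_mat n n" and R: "R \<in> carrier_mat m n"
    and pd: "\<And>v. v \<in> carrier_vec n \<Longrightarrow> v \<noteq> 0\<^sub>v n \<Longrightarrow> 0 < v \<bullet> (A *\<^sub>v v)"
    and inj: "\<And>w. w \<in> carrier_vec m \<Longrightarrow> R\<^sup>T *\<^sub>v w = 0\<^sub>v n \<Longrightarrow> w = 0\<^sub>v m"
  defines "Ac \<equiv> R * A * (2 \<cdot>\<^sub>m R\<^sup>T)"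
  shows "the (mat_inverse Ac) \<in> carrier_mat m m" "Ac * the (mat_inverse Ac) = 1\<^sub>m m"
proof -
  have P: "2 \<cdot>\<^sub>m R\<^sup>T \<in> carrier_mat n m" using R by simp
  have Ac: "Ac \<in> carrier_mat m m"
    unfolding Ac_def by (rule mult_carrier_mat[OF mult_carrier_mat[OF R A] P])
  have "det Ac \<noteq> 0"
  proof
    assume "det Ac = 0"
    then obtain w where w: "w \<in> carrier_vec m" "w \<noteq> 0\<^sub>v m" "Ac *\<^sub>v w = 0\<^sub>v m"
      using det_0_iff_vec_prod_zero_field[OF Ac] by blast
    define p where "p = R\<^sup>T *\<^sub>v w"
    have p: "p \<in> carrier_vec n" "p \<noteq> 0\<^sub>v n" using w R inj[of w] by (auto simp: p_def)
    have Pw: "(2 \<cdot>\<^sub>m R\<^sup>T) *\<^sub>v w = 2 \<cdot>\<^sub>v p"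
      unfolding p_def using R w by (intro smult_mat_mult_vec) auto
    have "Ac *\<^sub>v w = (R * A) *\<^sub>v (2 \<cdot>\<^sub>v p)"
      unfolding Ac_def Pw[symmetric] by (rule assoc_mult_mat_vec[OF mult_carrier_mat[OF R A] P w(1)])
    also have "\<dots> = R *\<^sub>v (2 \<cdot>\<^sub>v (A *\<^sub>v p))"
      using A R p by (subst assoc_mult_mat_vec[of _ m n _ n]) (auto simp: mult_mat_vec)
    finally have "0 = w \<bullet> (R *\<^sub>v (2 \<cdot>\<^sub>v (A *\<^sub>v p)))" using w by (metis scalar_prod_right_zero)
    also have "\<dots> = p \<bullet> (2 \<cdot>\<^sub>v (A *\<^sub>v p))"
      unfolding p_def using A R w p by (intro transpose_vec_mult_scalar[symmetric]) (auto simp: p_def)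
    also have "\<dots> = 2 * (p \<bullet> (A *\<^sub>v p))" using A p by simp
    finally show False using pd[OF p] by simp
  qed
  then have "Ac \<in> Units (ring_mat TYPE(real) m ())" by (rule det_non_zero_imp_unit[OF Ac])
  then have "mat_inverse Ac \<noteq> None" using mat_inverse(1)[OF Ac, of "()"] by blast
  then obtain X where "mat_inverse Ac = Some X" by auto
  with mat_inverse(2)[OF Ac this]
  show "the (mat_inverse Ac) \<in> carrier_mat m m" "Ac * the (mat_inverse Ac) = 1\<^sub>m m" by auto
qed

text \<open>Galerkin orthogonality: the inverse makes \<open>R\<close> annihilate
  \<open>A *\<^sub>v t\<close>, so \<open>t\<close> is \<open>A\<close>-orthogonal to the range of
  the prolongation, and Pythagoras bounds its energy.\<close>

lemma coarse_correction_orthogonal: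
  assumes A: "(A :: real mat) \<in> carrier_mat n n" "A\<^sup>T = A" and R: "R \<in> carrier_mat m n"
    and X: "X \<in> carrier_mat m m" "R * A * (2 \<cdot>\<^sub>m R\<^sup>T) * X = 1\<^sub>m m"
    and psd: "\<And>v. v \<in> carrier_vec n \<Longrightarrow> 0 \<le> v \<bullet> (A *\<^sub>v v)"
    and v: "v \<in> carrier_vec n"
  defines "t \<equiv> (1\<^sub>m n - (2 \<cdot>\<^sub>m R\<^sup>T) * X * R * A) *\<^sub>v v"
  shows "t \<in> carrier_vec n"
    and "w \<in> carrier_vec m \<Longrightarrow> ((2 \<cdot>\<^sub>m R\<^sup>T) *\<^sub>v w) \<bullet> (A *\<^sub>v t) = 0"
    and "t \<bullet> (A *\<^sub>v t) \<le> v \<bullet> (A *\<^sub>v v)"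
proof -
  let ?P = "2 \<cdot>\<^sub>m R\<^sup>T"
  have P: "?P \<in> carrier_mat n m" using R by simp
  define y where "y = R *\<^sub>v (A *\<^sub>v v)"
  define z where "z = X *\<^sub>v y"
  define p where "p = ?P *\<^sub>v z"
  have y: "y \<in> carrier_vec m" using R A v by (simp add: y_def)
  have z: "z \<in> carrier_vec m" using X y by (simp add: z_def)
  have p: "p \<in> carrier_vec n" using P z by (simp add: p_def)
  have t: "t = v - p"
  proof -
    have "(?P * X * R * A) *\<^sub>v v = p"
      unfolding p_def z_def y_def assoc_mult_mat_vec[OF mult_carrier_mat[OF mult_carrier_mat[OF P X(1)] R] A(1) v]
        assoc_mult_mat_vec[OF mult_carrier_mat[OF P X(1)] R mult_mat_vec_carrier[OF A(1) v]]
        assoc_mult_mat_vec[OF P X(1) mult_mat_vec_carrier[OF R mult_mat_vec_carrier[OF A(1) v]]] by simp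
    then show ?thesis
      unfolding t_def using v minus_mult_distrib_mat_vec[OF one_carrier_mat
          mult_carrier_mat[OF mult_carrier_mat[OF mult_carrier_mat[OF P X(1)] R] A(1)] v] by simp
  qed
  show tc: "t \<in> carrier_vec n" using v p by (simp add: t)
  have Pw: "(?P *\<^sub>v w) \<bullet> x = 2 * (w \<bullet> (R *\<^sub>v x))" if "w \<in> carrier_vec m" "x \<in> carrier_vec n" for w x
  proof -
    have "?P *\<^sub>v w = 2 \<cdot>\<^sub>v (R\<^sup>T *\<^sub>v w)"
      using R that by (intro smult_mat_mult_vec) auto
    then show ?thesis
      using R that transpose_vec_mult_scalar[OF R that(2,1)] by simp
  qed
  have "R *\<^sub>v (A *\<^sub>v p) = (R * A * ?P * X) *\<^sub>v y"
    unfolding p_def assoc_mult_mat_vec[OF mult_carrier_mat[OF mult_carrier_mat[OF R A(1)] P] X(1) y]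
      z_def[symmetric] assoc_mult_mat_vec[OF mult_carrier_mat[OF R A(1)] P z]
    using R A(1) p by (simp add: assoc_mult_mat_vec[of _ m n _ n] p_def)
  then have RAp: "R *\<^sub>v (A *\<^sub>v p) = y" using X y by simp
  have RAt: "R *\<^sub>v (A *\<^sub>v t) = 0\<^sub>v m"
  proof -
    have "A *\<^sub>v t = A *\<^sub>v v - A *\<^sub>v p" unfolding t by (rule mult_minus_distrib_mat_vec[OF A(1) v p])
    moreover have "R *\<^sub>v (A *\<^sub>v v - A *\<^sub>v p) = R *\<^sub>v (A *\<^sub>v v) - R *\<^sub>v (A *\<^sub>v p)"
      using A v p by (intro mult_minus_distrib_mat_vec[OF R]) auto
    ultimately show ?thesis using RAp y by (simp flip: y_def)
  qed
  show orth: "(?P *\<^sub>v w) \<bullet> (A *\<^sub>v t) = 0" if "w \<in> carrier_vec m" for w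
    using Pw[OF that, of "A *\<^sub>v t"] RAt that A tc by simp
  have "t \<bullet> (A *\<^sub>v t) = v \<bullet> (A *\<^sub>v v) - 2 * (p \<bullet> (A *\<^sub>v v)) + p \<bullet> (A *\<^sub>v p)"
    unfolding t by (rule form_diff[OF A v p])
  also have "p \<bullet> (A *\<^sub>v v) = p \<bullet> (A *\<^sub>v p)"
  proof -
    have "p \<bullet> (A *\<^sub>v v - A *\<^sub>v p) = 0"
      using orth[OF z] unfolding p_def[symmetric] t mult_minus_distrib_mat_vec[OF A(1) v p] .
    moreover have "p \<bullet> (A *\<^sub>v v - A *\<^sub>v p) = p \<bullet> (A *\<^sub>v v) - p \<bullet> (A *\<^sub>v p)"
      using A v p by (intro scalar_prod_minus_distrib) auto
    ultimately show ?thesis by simp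
  qed
  finally show "t \<bullet> (A *\<^sub>v t) \<le> v \<bullet> (A *\<^sub>v v)" using psd[OF p] by simp
qed

text \<open>Young's inequality with weight \<open>\<beta>\<close> replaces Cauchy--Schwarz: half of the energy is absorbed on the
  left.\<close>
lemma strong_approximation:
  assumes A: "(A :: real mat) \<in> carrier_mat n n"
    and d: "\<And>i. i < n \<Longrightarrow> 0 < A $$ (i, i)" and \<beta>: "0 < \<beta>"
    and t: "t \<in> carrier_vec n" and p: "p \<in> carrier_vec n" and orth: "p \<bullet> (A *\<^sub>v t) = 0"
    and approx: "(\<Sum>i<n. A $$ (i, i) * ((t - p) $ i)\<^sup>2) \<le> \<beta> * (t \<bullet> (A *\<^sub>v t))"
  shows "t \<bullet> (A *\<^sub>v t) \<le> \<beta> * ((A *\<^sub>v t) \<bullet> (diag_inv A *\<^sub>v (A *\<^sub>v t)))"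
proof -
  define a where "a = A *\<^sub>v t"
  define e where "e = t - p"
  have a: "a \<in> carrier_vec n" and e: "e \<in> carrier_vec n" using A t p by (auto simp: a_def e_def)
  have "t \<bullet> a = e \<bullet> a"
    using minus_scalar_prod_distrib[OF t p a] orth by (simp add: e_def a_def)
  also have "\<dots> = (\<Sum>i<n. e $ i * a $ i)" using a by (simp add: scalar_prod_def lessThan_atLeast0)
  also have "\<dots> \<le> (\<Sum>i<n. \<beta> / 2 * (1 / A $$ (i, i) * (a $ i)\<^sup>2) + 1 / (2 * \<beta>) * (A $$ (i, i) * (e $ i)\<^sup>2))"
  proof (intro sum_mono)
    fix i assume "i \<in> {..<n}"
    then have D: "0 < A $$ (i, i)" using d by simp
    have "0 \<le> (\<beta> * a $ i - A $$ (i, i) * e $ i)\<^sup>2 / (2 * \<beta> * A $$ (i, i))"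
      using D \<beta> by simp
    also have "\<dots> = \<beta> / 2 * (1 / A $$ (i, i) * (a $ i)\<^sup>2) + 1 / (2 * \<beta>) * (A $$ (i, i) * (e $ i)\<^sup>2) - e $ i * a $ i"
      using D \<beta> by (simp add: field_simps power2_eq_square)
    finally show "e $ i * a $ i \<le> \<beta> / 2 * (1 / A $$ (i, i) * (a $ i)\<^sup>2) + 1 / (2 * \<beta>) * (A $$ (i, i) * (e $ i)\<^sup>2)"
      by simp
  qed
  also have "\<dots> = \<beta> / 2 * (a \<bullet> (diag_inv A *\<^sub>v a)) + 1 / (2 * \<beta>) * (\<Sum>i<n. A $$ (i, i) * (e $ i)\<^sup>2)"
    using A diag_form_eq_sum[OF a, of "\<lambda>i. 1 / A $$ (i, i)"]
    by (simp add: sum.distrib sum_distrib_left diag_inv_def)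
  also have "\<dots> \<le> \<beta> / 2 * (a \<bullet> (diag_inv A *\<^sub>v a)) + 1 / (2 * \<beta>) * (\<beta> * (t \<bullet> a))"
    using approx \<beta> unfolding e_def a_def by (intro add_left_mono mult_left_mono) auto
  finally show ?thesis using \<beta> by (simp add: a_def field_simps)
qed

section \<open>The two-grid estimate\<close>

lemma restr_carrier: "restr N \<in> carrier_mat (N div 2 - 1) (N - 1)"
  by (simp add: restr_def)

lemma prolong_carrier: "prolong N \<in> carrier_mat (N - 1) (N div 2 - 1)"
  by (simp add: prolong_def restr_def)

text \<open>Zero-based, coarse node \<open>r\<close> sits at fine index \<open>2 * r + 1\<close>;
  doubling the weights 1/2 and 1/4 gives the hat function values 1 and 1/2.\<close>

lemma prolong_apply:
  assumes "w \<in> carrier_vec (M - 1)" "c < 2 * M - 1"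
  shows "(prolong (2 * M) *\<^sub>v w) $ c
    = (\<Sum>r<M - 1. (if c = 2 * r + 1 then 1 else if c = 2 * r \<or> c = 2 * r + 2 then 1 / 2 else 0) * w $ r)"
proof -
  have "(prolong (2 * M) *\<^sub>v w) $ c = (\<Sum>r<M - 1. prolong (2 * M) $$ (c, r) * w $ r)"
    using assms prolong_carrier[of "2 * M"] by (auto simp: scalar_prod_def lessThan_atLeast0 intro!: sum.cong)
  also have "\<dots> = (\<Sum>r<M - 1. (if c = 2 * r + 1 then 1 else if c = 2 * r \<or> c = 2 * r + 2 then 1 / 2 else 0) * w $ r)"
    using assms by (intro sum.cong) (auto simp: prolong_def restr_def Let_def)
  finally show ?thesis .
qed

lemma prolong_coarse_node:
  assumes "w \<in> carrier_vec (M - 1)" "k < M - 1"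
  shows "(prolong (2 * M) *\<^sub>v w) $ (2 * k + 1) = w $ k"
proof -
  have less: "2 * k + 1 < 2 * M - 1" using assms by simp
  have ne: "2 * k + 1 \<noteq> 2 * r" "2 * k + 1 \<noteq> 2 * r + 2" for r :: nat by presburger+
  have "(prolong (2 * M) *\<^sub>v w) $ (2 * k + 1) = (\<Sum>r<M - 1. if r = k then w $ k else 0)"
    unfolding prolong_apply[OF assms(1) less] by (intro sum.cong) (auto simp: ne)
  then show ?thesis using assms by simp
qed

lemma prolong_fine_node:
  assumes "w \<in> carrier_vec (M - 1)" "k < M"
  shows "(prolong (2 * M) *\<^sub>v w) $ (2 * k)
    = ((if 0 < k then w $ (k - 1) else 0) + (if k < M - 1 then w $ k else 0)) / 2"
proof -
  have less: "2 * k < 2 * M - 1" using assms by simp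
  have ne: "2 * k \<noteq> 2 * r + 1" for r :: nat by presburger
  \<comment> \<open>At \<open>k = 0\<close> truncated subtraction makes \<open>k - 1\<close> equal
    to 0; the guard \<open>0 < k\<close> suppresses that term at the left boundary.\<close>
  have "(prolong (2 * M) *\<^sub>v w) $ (2 * k)
      = (\<Sum>r<M - 1. (if r = k - 1 then if 0 < k then w $ (k - 1) / 2 else 0 else 0) + (if r = k then w $ k / 2 else 0))"
    unfolding prolong_apply[OF assms(1) less] by (intro sum.cong) (auto simp: ne)
  also have "\<dots> = ((if 0 < k then w $ (k - 1) else 0) + (if k < M - 1 then w $ k else 0)) / 2"
    using assms by (auto simp: sum.distrib)
  finally show ?thesis .
qed

lemma sum_even_odd:
  fixes g :: "nat \<Rightarrow> real"
  assumes "0 < M"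
  shows "(\<Sum>i<2 * M - 1. g i) = (\<Sum>k<M. g (2 * k)) + (\<Sum>k<M - 1. g (2 * k + 1))"
proof -
  have "(\<Sum>i<2 * m + 1. g i) = (\<Sum>k<Suc m. g (2 * k)) + (\<Sum>k<m. g (2 * k + 1))" for m
    by (induction m) auto
  from this[of "M - 1"] show ?thesis using assms by (cases M) auto
qed

text \<open>Back to the paper indices \<open>1, \<dots>, N - 1\<close>, extended by the boundary values at 0 and \<open>N\<close>.\<close>
definition grid_fun :: "nat \<Rightarrow> real vec \<Rightarrow> nat \<Rightarrow> real" where
  "grid_fun N v k = (if 0 < k \<and> k < N then v $ (k - 1) else 0)"

lemma Bh_form_eq:
  assumes "v \<in> carrier_vec (N - 1)"
  shows "v \<bullet> (Bh \<alpha> N *\<^sub>v v)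
    = (\<Sum>i\<in>{1..<N}. \<Sum>j\<in>{1..<N}. bentry \<alpha> N i j * grid_fun N v i * grid_fun N v j)"
proof -
  have shift: "(\<Sum>i<N - 1. f (Suc i)) = (\<Sum>i\<in>{1..<N}. f i)" for f :: "nat \<Rightarrow> real"
    by (rule sum.reindex_bij_witness[of _ "\<lambda>i. i - 1" Suc]) auto
  have "v \<bullet> (Bh \<alpha> N *\<^sub>v v) = (\<Sum>i<N - 1. \<Sum>j<N - 1. Bh \<alpha> N $$ (i, j) * v $ i * v $ j)"
    using assms by (intro form_eq_sum) (auto simp: Bh_def)
  also have "\<dots> = (\<Sum>i<N - 1. \<Sum>j<N - 1. bentry \<alpha> N (Suc i) (Suc j) * grid_fun N v (Suc i) * grid_fun N v (Suc j))"
    by (intro sum.cong) (auto simp: Bh_def grid_fun_def)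
  also have "\<dots> = (\<Sum>i<N - 1. \<Sum>j\<in>{1..<N}. bentry \<alpha> N (Suc i) j * grid_fun N v (Suc i) * grid_fun N v j)"
    by (rule sum.cong[OF refl], rule shift)
  also have "\<dots> = (\<Sum>i\<in>{1..<N}. \<Sum>j\<in>{1..<N}. bentry \<alpha> N i j * grid_fun N v i * grid_fun N v j)"
    by (rule shift)
  finally show ?thesis .
qed

section \<open>Transfer of the estimates to \<open>Bh\<close> and \<open>Aq\<close>\<close>

lemma Bh_carrier: "Bh \<alpha> N \<in> carrier_mat (N - 1) (N - 1)"
  by (simp add: Bh_def)

lemma smult_form:
  assumes "(A :: real mat) \<in> carrier_mat n n" "v \<in> carrier_vec n"
  shows "v \<bullet> ((c \<cdot>\<^sub>m A) *\<^sub>v v) = c * (v \<bullet> (A *\<^sub>v v))"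
  using assms by (simp add: smult_mat_mult_vec[of _ n n])

lemma Bh_pos_def:
  assumes \<alpha>: "1 < \<alpha>" "\<alpha> < 2" and N: "3 \<le> N" and v: "v \<in> carrier_vec (N - 1)" "v \<noteq> 0\<^sub>v (N - 1)"
  shows "0 < v \<bullet> (Bh \<alpha> N *\<^sub>v v)"
proof -
  obtain k where k: "k < N - 1" "v $ k \<noteq> 0" using v by (metis carrier_vecD eq_vecI index_zero_vec)
  then show ?thesis
    unfolding Bh_form_eq[OF v(1)] by (intro bentry_form_pos[OF \<alpha> N, of _ "Suc k"]) (auto simp: grid_fun_def)
qed

text \<open>Sampling \<open>v\<close> at the coarse nodes makes the error vanish there; elsewhere it
  is the linear interpolation error.\<close>

lemma Bh_approximation:
  assumes \<alpha>: "1 < \<alpha>" "\<alpha> < 2" and M: "2 \<le> M" and v: "v \<in> carrier_vec (2 * M - 1)"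
  obtains w where "w \<in> carrier_vec (M - 1)"
    "(\<Sum>i<2 * M - 1. Bh \<alpha> (2 * M) $$ (i, i) * ((v - prolong (2 * M) *\<^sub>v w) $ i)\<^sup>2)
       \<le> 5 / 2 * (v \<bullet> (Bh \<alpha> (2 * M) *\<^sub>v v))"
proof
  let ?N = "2 * M" and ?x = "grid_fun (2 * M) v"
  define w where "w = vec (M - 1) (\<lambda>k. v $ (2 * k + 1))"
  show w: "w \<in> carrier_vec (M - 1)" by (simp add: w_def)
  define e where "e = v - prolong ?N *\<^sub>v w"
  have ei: "e $ i = v $ i - (prolong ?N *\<^sub>v w) $ i" if "i < ?N - 1" for i
    using that prolong_carrier[of ?N] by (simp add: e_def)
  have odd: "e $ (2 * k + 1) = 0" if "k < M - 1" for k
    using ei[of "2 * k + 1"] prolong_coarse_node[OF w that] that by (simp add: w_def)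
  have even: "e $ (2 * k) = ?x (2 * k + 1) - (?x (2 * k) + ?x (2 * k + 2)) / 2" if "k < M" for k
  proof -
    have "(if 0 < k then w $ (k - 1) else 0) = ?x (2 * k)"
      using that by (auto simp: w_def grid_fun_def intro!: arg_cong[of _ _ "\<lambda>i. v $ i"])
    moreover have "(if k < M - 1 then w $ k else 0) = ?x (2 * k + 2)"
      using that by (auto simp: w_def grid_fun_def)
    moreover have "v $ (2 * k) = ?x (2 * k + 1)" using that by (simp add: grid_fun_def)
    ultimately show ?thesis using ei[of "2 * k"] prolong_fine_node[OF w that] that by simp
  qed
  have "(\<Sum>i<?N - 1. Bh \<alpha> ?N $$ (i, i) * (e $ i)\<^sup>2) = (\<Sum>k<M. Bh \<alpha> ?N $$ (2 * k, 2 * k) * (e $ (2 * k))\<^sup>2)"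
    using M odd by (subst sum_even_odd) auto
  also have "\<dots> = (\<Sum>k<M. bentry \<alpha> ?N (2 * k + 1) (2 * k + 1)
      * (?x (2 * k + 1) - (?x (2 * k) + ?x (2 * k + 2)) / 2)\<^sup>2)"
    by (intro sum.cong) (auto simp: Bh_def even)
  also have "\<dots> \<le> 5 / 2 * (v \<bullet> (Bh \<alpha> ?N *\<^sub>v v))"
    unfolding Bh_form_eq[OF v] using M by (intro interpolation_error_le[OF \<alpha>]) (auto simp: grid_fun_def)
  finally show "(\<Sum>i<?N - 1. Bh \<alpha> ?N $$ (i, i) * ((v - prolong ?N *\<^sub>v w) $ i)\<^sup>2)
       \<le> 5 / 2 * (v \<bullet> (Bh \<alpha> ?N *\<^sub>v v))" unfolding e_def .
qed

text \<open>The angle \<open>\<alpha> * pi / 2\<close> lies in the second quadrant, so the cosine is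
  negative and the factor positive; positivity and approximation then carry over from
  \<open>Bh\<close>.\<close>

lemma Aq_eq_smult_Bh:
  assumes "1 < \<alpha>" "\<alpha> < 2" "0 < b"
  obtains c where "0 < c" "Aq \<alpha> b q = c \<cdot>\<^sub>m Bh \<alpha> (2 ^ q)"
proof
  let ?c = "kappa \<alpha> / ((b / 2 ^ q) powr (\<alpha> - 1) * Gamma (4 - \<alpha>))"
  have "0 < sin (\<alpha> * pi / 2 - pi / 2)"
    using assms by (intro sin_gt_zero) (auto simp: field_simps)
  then have "cos (\<alpha> * pi / 2) < 0"
    by (simp add: sin_diff)
  then have "0 < kappa \<alpha>" by (simp add: kappa_def divide_neg_neg)
  moreover have "0 < Gamma (4 - \<alpha>)" using assms by (intro Gamma_real_pos) auto
  ultimately show "0 < ?c" using assms by simp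
  show "Aq \<alpha> b q = ?c \<cdot>\<^sub>m Bh \<alpha> (2 ^ q)" by (simp add: Aq_def Let_def)
qed

text \<open>Each quotient in the supremum is the root of an energy quotient; \<open>0 < n\<close>
  makes the set nonempty.\<close>

lemma opnorm_le:
  assumes "dim_col X = n" "0 < n"
    and pd: "\<And>v. v \<in> carrier_vec n \<Longrightarrow> v \<noteq> 0\<^sub>v n \<Longrightarrow> 0 < v \<bullet> (A *\<^sub>v v)"
    and le: "\<And>v. v \<in> carrier_vec n \<Longrightarrow> (X *\<^sub>v v) \<bullet> (A *\<^sub>v (X *\<^sub>v v)) \<le> r * (v \<bullet> (A *\<^sub>v v))"
  shows "opnorm A X \<le> sqrt r"
  unfolding opnorm_def assms(1)
proof (rule cSup_least)
  have "unit_vec n 0 \<in> carrier_vec n" "unit_vec n 0 \<noteq> (0\<^sub>v n :: real vec)" using assms(2) by auto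
  then show "{vnorm A (X *\<^sub>v v) / vnorm A v |v. v \<in> carrier_vec n \<and> v \<noteq> 0\<^sub>v n} \<noteq> {}" by blast
  fix y assume "y \<in> {vnorm A (X *\<^sub>v v) / vnorm A v |v. v \<in> carrier_vec n \<and> v \<noteq> 0\<^sub>v n}"
  then obtain v where v: "v \<in> carrier_vec n" "v \<noteq> 0\<^sub>v n" and y: "y = vnorm A (X *\<^sub>v v) / vnorm A v" by blast
  have "y = sqrt ((X *\<^sub>v v) \<bullet> (A *\<^sub>v (X *\<^sub>v v)) / (v \<bullet> (A *\<^sub>v v)))"
    by (simp add: y vnorm_def real_sqrt_divide)
  also have "\<dots> \<le> sqrt r"
    using le[OF v(1)] pd[OF v] by (simp add: divide_le_eq)
  finally show "y \<le> sqrt r" .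
qed

theorem theorem3p5:
  fixes \<alpha> b \<eta>\<^sub>0 \<omega> \<eta> :: real and q :: nat
  assumes "1 < \<alpha>" "\<alpha> < 2" "b > 0" "q \<ge> 2"
    and "\<forall>ev. eigenvalue (diag_inv (Aq \<alpha> b q) * Aq \<alpha> b q) ev \<longrightarrow> ev \<le> \<eta>\<^sub>0"
    and "\<eta>\<^sub>0 < 2"
    and "0 < \<omega>" "\<omega> < 2 / \<eta>\<^sub>0"
    and "0 < \<eta>" "\<eta> \<le> \<omega> * (2 - \<omega> * \<eta>\<^sub>0)"
  shows "(\<forall>v \<in> carrier_vec (2 ^ q - 1).
            (vnorm (Aq \<alpha> b q) (jacobi \<omega> (Aq \<alpha> b q) *\<^sub>v v))\<^sup>2
              \<le> (vnorm (Aq \<alpha> b q) v)\<^sup>2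
                 - \<eta> * (vnorm (diag_inv (Aq \<alpha> b q)) (Aq \<alpha> b q *\<^sub>v v))\<^sup>2)
      \<and> opnorm (Aq \<alpha> b q) (jacobi \<omega> (Aq \<alpha> b q) * cgc (2 ^ q) (Aq \<alpha> b q)) \<le> sqrt (1 - 2 * \<eta> / 5)
      \<and> sqrt (1 - 2 * \<eta> / 5) < 1"
proof -
  define A where "A = Aq \<alpha> b q"
  define M :: nat where "M = 2 ^ (q - 1)"
  define n where "n = 2 * M - 1"
  have N: "(2::nat) ^ q = 2 * M" using assms(4) by (cases q) (auto simp: M_def)
  have "(2::nat) ^ 1 \<le> M" unfolding M_def using assms(4) by (intro power_increasing) auto
  then have M: "2 \<le> M" by simp
  have N3: "3 \<le> 2 * M" and n: "0 < n" using M by (auto simp: n_def)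
  obtain c where c: "0 < c" and A_eq: "A = c \<cdot>\<^sub>m Bh \<alpha> (2 * M)"
    using Aq_eq_smult_Bh[OF assms(1-3), of q] unfolding N A_def by blast
  have B: "Bh \<alpha> (2 * M) \<in> carrier_mat n n" unfolding n_def by (rule Bh_carrier)
  have A: "A \<in> carrier_mat n n" using B by (simp add: A_eq)
  have A_sym: "A\<^sup>T = A"
    unfolding A_eq Bh_def by (rule eq_matI) (auto intro: bentry_sym)
  have form: "v \<bullet> (A *\<^sub>v v) = c * (v \<bullet> (Bh \<alpha> (2 * M) *\<^sub>v v))" if "v \<in> carrier_vec n" for v
    unfolding A_eq by (rule smult_form[OF B that])
  have pd: "0 < v \<bullet> (A *\<^sub>v v)" if "v \<in> carrier_vec n" "v \<noteq> 0\<^sub>v n" for v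
    using Bh_pos_def[OF assms(1,2) N3] that c by (simp add: form n_def)
  have psd: "0 \<le> v \<bullet> (A *\<^sub>v v)" if "v \<in> carrier_vec n" for v
    using pd[OF that] A that by (cases "v = 0\<^sub>v n") (auto simp: scalar_prod_def)
  have d: "0 < A $$ (i, i)" if "i < n" for i
    using bentry_diag_pos[OF assms(1,2) N3, of "i + 1"] that c by (auto simp: A_eq Bh_def n_def)

  \<comment> \<open>Smoothing property and the bound on \<eta>\<close>
  let ?K = "jacobi \<omega> A" and ?D = "diag_inv A"
  have ev: "\<And>ev. eigenvalue (?D * A) ev \<Longrightarrow> ev \<le> \<eta>\<^sub>0" using assms(5) by (simp add: A_def)
  have Dc: "?D \<in> carrier_mat n n" using A by (simp add: diag_inv_def)
  have Kc: "?K \<in> carrier_mat n n"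
    using A Dc unfolding jacobi_def by (intro minus_carrier_mat smult_carrier_mat mult_carrier_mat[of _ n n])
  have smoothing: "(?K *\<^sub>v v) \<bullet> (A *\<^sub>v (?K *\<^sub>v v))
      \<le> v \<bullet> (A *\<^sub>v v) - \<eta> * ((A *\<^sub>v v) \<bullet> (?D *\<^sub>v (A *\<^sub>v v)))" if "v \<in> carrier_vec n" for v
    by (rule jacobi_smoothing[OF A A_sym n _ _ assms(10) that]) (use d ev in auto)
  have D_psd: "0 \<le> v \<bullet> (?D *\<^sub>v v)" if "v \<in> carrier_vec n" for v
    using diag_form_eq_sum[OF that, of "\<lambda>i. 1 / A $$ (i, i)"] A d[THEN less_imp_le]
    by (auto simp: diag_inv_def intro!: sum_nonneg)
  have smooth: "(vnorm A (?K *\<^sub>v v))\<^sup>2 \<le> (vnorm A v)\<^sup>2 - \<eta> * (vnorm ?D (A *\<^sub>v v))\<^sup>2"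
    if v: "v \<in> carrier_vec n" for v
    using smoothing[OF v] psd[OF v] psd[OF mult_mat_vec_carrier[OF Kc v]] D_psd[OF mult_mat_vec_carrier[OF A v]]
    by (simp add: vnorm_square)
  \<comment> \<open>Makes \<open>1 - 2 * \<eta> / 5\<close> nonnegative. A unit vector has equal
    \<open>A\<close> and diagonal energies, so \<open>1 \<le> \<eta>\<^sub>0\<close> and \<eta>
    \<le> 2 \<omega> - \<omega>^2 \<le> 1.\<close>
  have "\<eta> \<le> 1"
  proof -
    let ?u = "unit_vec n 0 :: real vec"
    have u: "?u \<in> carrier_vec n" by simp
    have "?u \<bullet> (A *\<^sub>v ?u) \<le> \<eta>\<^sub>0 * (?u \<bullet> (mat_diag n (\<lambda>i. A $$ (i, i)) *\<^sub>v ?u))"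
      using ev d A by (intro form_le_max_eigenvalue[OF A A_sym n _ _ u]) (auto simp: diag_inv_def)
    moreover have "?u \<bullet> (A *\<^sub>v ?u) = A $$ (0, 0)"
      using A n by simp
    moreover have "?u \<bullet> (mat_diag n (\<lambda>i. A $$ (i, i)) *\<^sub>v ?u) = A $$ (0, 0)"
      using scalar_prod_left_unit[OF mult_mat_vec_carrier[OF mat_diag_dim u] n] mat_diag_mult_vec[OF u n] n
      by simp
    ultimately have "1 \<le> \<eta>\<^sub>0" using d[OF n] by simp
    then have "\<omega> * \<omega> * 1 \<le> \<omega> * \<omega> * \<eta>\<^sub>0" by (intro mult_left_mono) auto
    moreover have "0 \<le> (\<omega> - 1) * (\<omega> - 1)" by simp
    ultimately show ?thesis using assms(10) by (simp add: algebra_simps)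
  qed

  \<comment> \<open>Coarse grid correction and contraction\<close>
  let ?T = "cgc (2 * M) A"
  have R: "restr (2 * M) \<in> carrier_mat (M - 1) n" using restr_carrier[of "2 * M"] by (simp add: n_def)
  have P: "prolong (2 * M) = 2 \<cdot>\<^sub>m (restr (2 * M))\<^sup>T" by (simp add: prolong_def)
  \<comment> \<open>The prolongation reproduces \<open>w\<close> at the coarse nodes.\<close>
  have inj: "w = 0\<^sub>v (M - 1)" if w: "w \<in> carrier_vec (M - 1)" and 0: "(restr (2 * M))\<^sup>T *\<^sub>v w = 0\<^sub>v n" for w
  proof (rule eq_vecI)
    fix k assume "k < dim_vec (0\<^sub>v (M - 1) :: real vec)"
    then have k: "k < M - 1" by simp
    have "prolong (2 * M) *\<^sub>v w = 2 \<cdot>\<^sub>v 0\<^sub>v n"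
      unfolding P 0[symmetric] using R w by (intro smult_mat_mult_vec) auto
    then show "w $ k = 0\<^sub>v (M - 1) $ k"
      using prolong_coarse_node[OF w k] k by (simp add: n_def)
  qed (use w in auto)
  let ?X = "the (mat_inverse (coarse_mat (2 * M) A))"
  have X: "?X \<in> carrier_mat (M - 1) (M - 1)"
    "restr (2 * M) * A * (2 \<cdot>\<^sub>m (restr (2 * M))\<^sup>T) * ?X = 1\<^sub>m (M - 1)"
    unfolding coarse_mat_def P
    by (rule coarse_inverse[OF A R], rule pd, assumption+, rule inj, assumption+)+
  have T: "?T = 1\<^sub>m n - (2 \<cdot>\<^sub>m (restr (2 * M))\<^sup>T) * ?X * restr (2 * M) * A"
    unfolding cgc_def n_def P by (rule refl)
  have Tc: "?T \<in> carrier_mat n n"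
    unfolding T using A R by (intro carrier_matI) auto
  have TGM: "((?K * ?T) *\<^sub>v v) \<bullet> (A *\<^sub>v ((?K * ?T) *\<^sub>v v)) \<le> (1 - 2 * \<eta> / 5) * (v \<bullet> (A *\<^sub>v v))"
    if v: "v \<in> carrier_vec n" for v
  proof -
    define t where "t = ?T *\<^sub>v v"
    note T_props = coarse_correction_orthogonal[OF A A_sym R X _ v, folded T t_def P]
    have t: "t \<in> carrier_vec n" by (rule T_props(1)) (rule psd)
    have orth: "(prolong (2 * M) *\<^sub>v w) \<bullet> (A *\<^sub>v t) = 0" if "w \<in> carrier_vec (M - 1)" for w
      by (rule T_props(2)[OF _ that]) (rule psd)
    have t_le: "t \<bullet> (A *\<^sub>v t) \<le> v \<bullet> (A *\<^sub>v v)" by (rule T_props(3)) (rule psd)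
    obtain w where w: "w \<in> carrier_vec (M - 1)"
      and approx: "(\<Sum>i<n. Bh \<alpha> (2 * M) $$ (i, i) * ((t - prolong (2 * M) *\<^sub>v w) $ i)\<^sup>2)
        \<le> 5 / 2 * (t \<bullet> (Bh \<alpha> (2 * M) *\<^sub>v t))"
      using Bh_approximation[OF assms(1,2) M t[unfolded n_def]] unfolding n_def by blast
    have "(\<Sum>i<n. A $$ (i, i) * ((t - prolong (2 * M) *\<^sub>v w) $ i)\<^sup>2)
        = c * (\<Sum>i<n. Bh \<alpha> (2 * M) $$ (i, i) * ((t - prolong (2 * M) *\<^sub>v w) $ i)\<^sup>2)"
      using B by (auto simp: A_eq sum_distrib_left mult.assoc intro!: sum.cong)
    also have "\<dots> \<le> c * (5 / 2 * (t \<bullet> (Bh \<alpha> (2 * M) *\<^sub>v t)))"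
      using approx c by (intro mult_left_mono) auto
    also have "\<dots> = 5 / 2 * (t \<bullet> (A *\<^sub>v t))" by (simp add: form[OF t])
    finally have "t \<bullet> (A *\<^sub>v t) \<le> 5 / 2 * ((A *\<^sub>v t) \<bullet> (?D *\<^sub>v (A *\<^sub>v t)))"
      using prolong_carrier[of "2 * M"] w orth[OF w] t d
      by (intro strong_approximation[where p = "prolong (2 * M) *\<^sub>v w", OF A])
        (auto simp: n_def intro!: mult_mat_vec_carrier[of _ _ "M - 1"])
    \<comment> \<open>The decrease guaranteed by smoothing is at least the fraction
      \<open>2 * \<eta> / 5\<close> of the energy of \<open>t\<close>.\<close>
    then have "2 * \<eta> / 5 * (t \<bullet> (A *\<^sub>v t)) \<le> \<eta> * ((A *\<^sub>v t) \<bullet> (?D *\<^sub>v (A *\<^sub>v t)))"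
      using mult_left_mono[of _ _ "2 * \<eta> / 5"] assms(9) by fastforce
    with smoothing[OF t] have "(?K *\<^sub>v t) \<bullet> (A *\<^sub>v (?K *\<^sub>v t)) \<le> (1 - 2 * \<eta> / 5) * (t \<bullet> (A *\<^sub>v t))"
      by (simp add: algebra_simps)
    also have "\<dots> \<le> (1 - 2 * \<eta> / 5) * (v \<bullet> (A *\<^sub>v v))"
      using t_le \<open>\<eta> \<le> 1\<close> by (intro mult_left_mono) auto
    also have "?K *\<^sub>v t = (?K * ?T) *\<^sub>v v"
      unfolding t_def by (rule assoc_mult_mat_vec[OF Kc Tc v, symmetric])
    finally show ?thesis .
  qed
  have "opnorm A (?K * ?T) \<le> sqrt (1 - 2 * \<eta> / 5)"
    using Tc n pd TGM by (intro opnorm_le[of _ n]) auto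
  moreover have "sqrt (1 - 2 * \<eta> / 5) < 1" using assms(9) by simp
  ultimately show ?thesis
    using smooth unfolding A_def[symmetric] N n_def by blast
qed

end
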